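(* Let $M\in\mathbb R_+^{m\times m}$ be an entrywise nonnegative matrix, and let $\boldsymbol\Delta_{\mathbb{RC}}$ and $\boldsymbol\Delta$ be the sets of $m\times m$ matrices defined in the context. Then robust stability with respect to the unit ball of $\boldsymbol\Delta_{\mathbb{RC}}$ is equivalent to robust stability with respect to the unit ball of $\boldsymbol\Delta$, that is, $\mu(M,\boldsymbol\Delta_{\mathbb{RC}})<1$ if and only if $\mu(M,\boldsymbol\Delta)<1$; in other words, $$\mu(M,\boldsymbol\Delta_{\mathbb{RC}})=\mu(M,\boldsymbol\Delta).$$
   Context: Fix integers $f,s\ge 0$, block sizes $m_1,\dots,m_{f+s}\ge1$ with $\sum_i m_i=m$, and a partition $\{1,\dots,f+s\}=\mathcal I_{\mathbb R}\cup\mathcal I_{\mathbb C}$ into disjoint sets. Let $\boldsymbol\Delta_{\mathbb{RC}}$ be the set of block diagonal matrices $\mathrm{diag}(\Delta_1,\dots,\Delta_f,\delta_{f+1}I_{m_{f+1}},\dots,\delta_{f+s}I_{m_{f+s}})$ where, for $i\le f$, $\Delta_i\in\mathbb R^{m_i\times m_i}$ if $i\in\mathcal I_{\mathbb R}$ and $\Delta_i\in\mathbb C^{m_i\times m_i}$ if $i\in\mathcal I_{\mathbb C}$; and for $f<i\le f+s$, $\delta_i\in\mathbb R$ if $i\in\mathcal I_{\mathbb R}$ and $\delta_i\in\mathbb C$ if $i\in\mathcal I_{\mathbb C}$. Let $\bar s:=\sum_{k=f+1}^{f+s}m_k$ and $$\boldsymbol\Delta=\{\mathrm{diag}(\Delta_1,\dots,\Delta_f,\delta_{f+1},\dots,\delta_{f+\bar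 s}):\ \Delta_k\in\mathbb R_+^{m_k\times m_k}\ (1\le k\le f),\ \delta_k\in\mathbb R_+\ (f+1\le k\le f+\bar s)\},$$ where $\mathbb R_+=[0,\infty)$. $\|\cdot\|$ is the spectral norm (largest singular value); the unit ball of a set of matrices consists of its elements with $\|\Delta\|\le1$. For $A\in\mathbb C^{m\times m}$ and a set $\mathbf D\subset\mathbb C^{m\times m}$, the structured singular value is $$\mu(A,\mathbf D):=\frac1{\inf\{\|\Delta\|:\Delta\in\mathbf D,\ \det(I-A\Delta)=0\}},$$ with $\mu(A,\mathbf D)=0$ if no $\Delta\in\mathbf D$ satisfies $\det(I-A\Delta)=0$. For a constant matrix $M$, robust stability with respect to the unit ball of $\mathbf D$ means $\mu(M,\mathbf D)<1$. *)

theory Defs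
  imports "Jordan_Normal_Form.Spectral_Radius" "Jordan_Normal_Form.Schur_Decomposition"
begin

(* The eigenvalues of A^H A are real and nonnegative, so Re loses no information. *)
definition singular_values :: "complex mat \<Rightarrow> real set" where
  "singular_values A = (\<lambda>l. sqrt (Re l)) ` spectrum (mat_adjoint A * A)"

(* A matrix without columns has no singular values; Max would then be unspecified. *)
definition spectral_norm :: "complex mat \<Rightarrow> real" where
  "spectral_norm A = (if dim_col A = 0 then 0 else Max (singular_values A))"

definition destabilizing :: "complex mat \<Rightarrow> complex mat set \<Rightarrow> complex mat set" where
  "destabilizing A D = {\<Delta> \<in> D. det (1\<^sub>m (dim_row A) - A * \<Delta>) = 0}"

(* Meant for square A and a set D of square matrices of the same size. The infimum is then
   positive: det (I - A * \<Delta>) = 0 forces 1 \<le> spectral_norm A * spectral_norm \<Delta>.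
   So \<mu> is a real number, and the division is never by 0. *)
definition structured_singular_value :: "complex mat \<Rightarrow> complex mat set \<Rightarrow> real" where
  "structured_singular_value A D =
     (if destabilizing A D = {} then 0
      else 1 / (INF \<Delta>\<in>destabilizing A D. spectral_norm \<Delta>))"

definition robustly_stable_unit_ball :: "complex mat \<Rightarrow> complex mat set \<Rightarrow> bool" where
  "robustly_stable_unit_ball A D \<longleftrightarrow> structured_singular_value A D < 1"

(* Blocks are numbered 1, ..., f + s and block i has size ms i. An index in IR carries real
   data; every other index carries complex data. *)
definition Delta_RC :: "nat \<Rightarrow> nat \<Rightarrow> (nat \<Rightarrow> nat) \<Rightarrow> nat set \<Rightarrow> complex mat set" where
  "Delta_RC f s ms IR =
     {diag_block_mat (map D [1..<f + 1] @
                      map (\<lambda>i. \<delta> i \<cdot>\<^sub>m 1\<^sub>m (ms i)) [f + 1..<f + s + 1]) | D \<delta>.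
        (\<forall>i\<in>{1..f}. D i \<in> carrier_mat (ms i) (ms i) \<and>
                    (i \<in> IR \<longrightarrow> elements_mat (D i) \<subseteq> \<real>)) \<and>
        (\<forall>i\<in>{f + 1..f + s}. i \<in> IR \<longrightarrow> \<delta> i \<in> \<real>)}"

(* Each repeated scalar block of size ms k becomes ms k independent scalar (1 x 1) blocks. *)
definition Delta_nonneg :: "nat \<Rightarrow> nat \<Rightarrow> (nat \<Rightarrow> nat) \<Rightarrow> complex mat set" where
  "Delta_nonneg f s ms =
     (let sbar = (\<Sum>k=f + 1..f + s. ms k) in
      {map_mat complex_of_real
         (diag_block_mat (map D [1..<f + 1] @
                          map (\<lambda>k. \<delta> k \<cdot>\<^sub>m 1\<^sub>m 1) [f + 1..<f + sbar + 1])) | D \<delta>.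
         (\<forall>k\<in>{1..f}. D k \<in> carrier_mat (ms k) (ms k) \<and> elements_mat (D k) \<subseteq> {0..}) \<and>
         (\<forall>k\<in>{f + 1..f + sbar}. 0 \<le> \<delta> k)})"

lemma diag_block_mat_blocks_carrier:
  assumes "\<And>i. i \<in> set is \<Longrightarrow> B i \<in> carrier_mat (n i) (n i)"
    and "\<And>j. j \<in> set js \<Longrightarrow> C j \<in> carrier_mat (k j) (k j)"
  shows "diag_block_mat (map B is @ map C js) \<in>
    carrier_mat (sum_list (map n is) + sum_list (map k js))
                (sum_list (map n is) + sum_list (map k js))"
proof -
  have B: "map (dim_row \<circ> B) is = map n is" "map (dim_col \<circ> B) is = map n is"
    using assms(1) by (auto intro!: map_cong)
  have C: "map (dim_row \<circ> C) js = map k js" "map (dim_col \<circ> C) js = map k js"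
    using assms(2) by (auto intro!: map_cong)
  show ?thesis
    by (intro carrier_matI) (simp_all add: dim_diag_block_mat B C)
qed

lemma Delta_RC_carrier:
  assumes "(\<Sum>i=1..f + s. ms i) = m"
  shows "Delta_RC f s ms IR \<subseteq> carrier_mat m m"
proof
  fix X assume "X \<in> Delta_RC f s ms IR"
  then obtain D \<delta> where
    X: "X = diag_block_mat (map D [1..<f + 1] @
              map (\<lambda>i. \<delta> i \<cdot>\<^sub>m 1\<^sub>m (ms i)) [f + 1..<f + s + 1])"
    and D: "\<forall>i\<in>{1..f}. D i \<in> carrier_mat (ms i) (ms i) \<and>
                    (i \<in> IR \<longrightarrow> elements_mat (D i) \<subseteq> \<real>)"
    unfolding Delta_RC_def mem_Collect_eq by (elim exE conjE)
  have "{1..f + s} = {1..<f + 1} \<union> {f + 1..<f + s + 1}"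
    by auto
  then have "sum ms {1..<f + 1} + sum ms {f + 1..<f + s + 1} = m"
    unfolding assms[symmetric] by (simp only:, subst sum.union_disjoint, auto)
  then have sz: "sum_list (map ms [1..<f + 1]) + sum_list (map ms [f + 1..<f + s + 1]) = m"
    by (simp only: interv_sum_list_conv_sum_set_nat set_upt)
  have "X \<in> carrier_mat (sum_list (map ms [1..<f + 1]) + sum_list (map ms [f + 1..<f + s + 1]))
                        (sum_list (map ms [1..<f + 1]) + sum_list (map ms [f + 1..<f + s + 1]))"
    unfolding X by (rule diag_block_mat_blocks_carrier) (use D in auto)
  then show "X \<in> carrier_mat m m"
    by (simp only: sz)
qed

lemma Delta_nonneg_carrier:
  assumes "(\<Sum>i=1..f + s. ms i) = m"
  shows "Delta_nonneg f s ms \<subseteq> carrier_mat m m"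
proof
  define sbar where "sbar = (\<Sum>k=f + 1..f + s. ms k)"
  fix X assume "X \<in> Delta_nonneg f s ms"
  then obtain D :: "nat \<Rightarrow> real mat" and \<delta> :: "nat \<Rightarrow> real" where
    X: "X = map_mat complex_of_real (diag_block_mat (map D [1..<f + 1] @
              map (\<lambda>k. \<delta> k \<cdot>\<^sub>m 1\<^sub>m 1) [f + 1..<f + sbar + 1]))"
    and D: "\<forall>k\<in>{1..f}. D k \<in> carrier_mat (ms k) (ms k) \<and> elements_mat (D k) \<subseteq> {0..}"
    unfolding Delta_nonneg_def Let_def mem_Collect_eq sbar_def[symmetric] by (elim exE conjE)
  have "{1..f + s} = {1..<f + 1} \<union> {f + 1..f + s}"
    by auto
  then have "sum ms {1..<f + 1} + sbar = m"
    unfolding assms[symmetric] sbar_def by (simp only:, subst sum.union_disjoint, auto)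
  moreover have "sum_list (map (\<lambda>_. 1) [f + 1..<f + sbar + 1]) = sbar"
    by (simp add: sum_list_triv del: upt_Suc)
  ultimately have sz: "sum_list (map ms [1..<f + 1]) +
      sum_list (map (\<lambda>_. 1) [f + 1..<f + sbar + 1]) = m"
    by (simp only: interv_sum_list_conv_sum_set_nat set_upt)
  have "diag_block_mat (map D [1..<f + 1] @ map (\<lambda>k. \<delta> k \<cdot>\<^sub>m 1\<^sub>m 1) [f + 1..<f + sbar + 1]) \<in>
      carrier_mat
        (sum_list (map ms [1..<f + 1]) + sum_list (map (\<lambda>_. 1) [f + 1..<f + sbar + 1]))
        (sum_list (map ms [1..<f + 1]) + sum_list (map (\<lambda>_. 1) [f + 1..<f + sbar + 1]))"
    by (rule diag_block_mat_blocks_carrier) (use D in auto)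
  then show "X \<in> carrier_mat m m"
    unfolding X sz by simp
qed

end

theory Submission
  imports Defs "HOL-Analysis.L2_Norm"
begin

text \<open>
  If \<open>M \<Delta> z = z\<close> with \<open>z \<noteq> 0\<close> and \<open>\<Delta>'\<close> is a nonnegative matrix with \<open>|\<Delta> z| \<le> \<Delta>' |z|\<close> entrywise, then
  \<open>|z| \<le> M \<Delta>' |z|\<close>, so by a Perron-Frobenius argument \<open>I - t M \<Delta>'\<close> is singular for some \<open>0 \<le> t \<le> 1\<close>,
  and \<open>t \<Delta>'\<close> is destabilizing. It remains to choose \<open>\<Delta>'\<close> in the other uncertainty set with
  \<open>\<parallel>\<Delta>'\<parallel> \<le> \<parallel>\<Delta>\<parallel>\<close>. Starting from real or complex data, replace each full block, mapping \<open>x\<close> to \<open>y\<close>,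
  by the rank one block \<open>|y| |x|\<^sup>T / \<parallel>x\<parallel>\<^sup>2\<close>, and each scalar by its modulus. Starting from nonnegative
  data, keep the full blocks and replace all the scalars by \<open>\<parallel>\<Delta>\<parallel>\<close>.
\<close>

subsection \<open>Nonnegative matrices\<close>

text \<open>In general neither uncertainty set contains the other: one allows signs and complex
  phases, the other lets the entries of a repeated scalar block vary independently. So destabilizing
  matrices are compared one at a time, by norm only. Raising every scalar to the norm of the whole
  matrix is free because the spectral norm of a block diagonal matrix is the largest norm of a
  block; it also makes the scalars equal, as every pattern of repetitions permits. The factor
  \<open>t\<close> does no harm: scaling by a number in [0, 1] respects the structure and does not
  increase the norm. The Perron-Frobenius step works without eigenvectors. If no \<open>t\<close>
  gave a singular matrix, some positive vector would be strictly decreased by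
  \<open>N = M \<Delta>'\<close>, and its least multiple above |z| would give a contradiction. A
  second obstacle is the spectral norm, defined by eigenvalues, while the constructions need bounds
  on the length of \<open>A v\<close>. That the largest singular value is such a bound is usually
  read off a unitary diagonalization; here it is derived from the boundedness of the powers of a
  matrix with spectral radius below 1.\<close>

lemma continuous_on_det:
  fixes A :: "real \<Rightarrow> real mat"
  assumes "\<And>t. A t \<in> carrier_mat n n"
    and "\<And>i j. i < n \<Longrightarrow> j < n \<Longrightarrow> continuous_on S (\<lambda>t. A t $$ (i, j))"
  shows "continuous_on S (\<lambda>t. det (A t))"
  unfolding det_def'[OF assms(1)]
  by (intro continuous_intros assms(2)) (auto dest: permutes_in_image)

lemma continuous_on_cofactor:
  fixes A :: "real \<Rightarrow> real mat"
  assumes A: "\<And>t. A t \<in> carrier_mat n n"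
    and cont: "\<And>i j. i < n \<Longrightarrow> j < n \<Longrightarrow> continuous_on S (\<lambda>t. A t $$ (i, j))"
    and "i < n" "j < n"
  shows "continuous_on S (\<lambda>t. cofactor (A t) i j)"
proof -
  have "continuous_on S (\<lambda>t. det (mat_delete (A t) i j))"
  proof (rule continuous_on_det[where n = "n - 1"])
    show "mat_delete (A t) i j \<in> carrier_mat (n - 1) (n - 1)" for t
      using mat_delete_carrier[OF A] .
    show "continuous_on S (\<lambda>t. mat_delete (A t) i j $$ (k, l))" if "k < n - 1" "l < n - 1" for k l
      using that A by (auto simp: mat_delete_def carrier_matD[OF A] intro!: cont)
  qed
  then show ?thesis
    unfolding cofactor_def by (intro continuous_intros)
qed

lemma smult_mat_mult_vec:
  fixes c :: "'a :: comm_ring_1"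
  assumes "A \<in> carrier_mat n k" "v \<in> carrier_vec k"
  shows "(c \<cdot>\<^sub>m A) *\<^sub>v v = c \<cdot>\<^sub>v (A *\<^sub>v v)"
  using assms by (auto simp: scalar_prod_def sum_distrib_left mult_ac intro!: eq_vecI sum.cong)

lemma mult_mat_vec_index_sum:
  assumes "A \<in> carrier_mat n k" "v \<in> carrier_vec k" "i < n"
  shows "(A *\<^sub>v v) $ i = (\<Sum>j<k. A $$ (i, j) * v $ j)"
  using assms by (auto simp: scalar_prod_def lessThan_atLeast0 intro!: sum.cong)

text \<open>The vector \<open>y(t) = (I - t N)\<^sup>-\<^sup>1 (1, \<dots>, 1)\<close> satisfies \<open>y(t) = (1, \<dots>, 1) + t N y(t)\<close>, so once it is
  nonnegative it is at least 1 everywhere; hence it cannot leave the nonnegative orthant.\<close>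

lemma positive_strict_supersolution:
  fixes N :: "real mat"
  assumes N: "N \<in> carrier_mat n n" and N0: "\<And>i j. i < n \<Longrightarrow> j < n \<Longrightarrow> 0 \<le> N $$ (i, j)"
    and det: "\<And>t. 0 \<le> t \<Longrightarrow> t \<le> 1 \<Longrightarrow> det (1\<^sub>m n - t \<cdot>\<^sub>m N) \<noteq> 0"
  shows "\<exists>y \<in> carrier_vec n. \<forall>i<n. 0 < y $ i \<and> (N *\<^sub>v y) $ i < y $ i"
proof -
  define A where "A t = 1\<^sub>m n - t \<cdot>\<^sub>m N" for t
  have A: "A t \<in> carrier_mat n n" for t
    using N by (auto simp: A_def intro!: minus_carrier_mat)
  have Acont: "continuous_on S (\<lambda>t. A t $$ (i, j))" if "i < n" "j < n" for i j S
    using that N by (auto simp: A_def intro!: continuous_intros)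
  \<comment> \<open>Cramer's rule instead of an abstract inverse: each entry is a polynomial in
    \<open>t\<close> divided by a determinant that does not vanish on [0, 1], so it is continuous
    there.\<close>
  define y where "y t = (1 / det (A t)) \<cdot>\<^sub>v (adj_mat (A t) *\<^sub>v vec n (\<lambda>_. 1))" for t
  have y: "y t \<in> carrier_vec n" for t
    unfolding y_def by (intro smult_carrier_vec[THEN iffD2] mult_mat_vec_carrier[OF adj_mat(1)[OF A]]) simp
  have fix_eq: "y t $ i = 1 + t * (N *\<^sub>v y t) $ i" if t: "t \<in> {0..1}" and i: "i < n" for t i
  proof -
    have "A t *\<^sub>v y t = (1 / det (A t)) \<cdot>\<^sub>v ((A t * adj_mat (A t)) *\<^sub>v vec n (\<lambda>_. 1))"
      using adj_mat(1)[OF A[of t]] A[of t]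
      by (simp add: y_def mult_mat_vec assoc_mult_mat_vec[of _ n n _ n])
    also have "\<dots> = vec n (\<lambda>_. 1)"
      using det[of t] t A[of t] unfolding adj_mat(2)[OF A] A_def[symmetric]
      by (auto simp: smult_mat_mult_vec[of "1\<^sub>m n" n n])
    finally have "(A t *\<^sub>v y t) $ i = 1"
      using i by simp
    moreover have "A t *\<^sub>v y t = y t - t \<cdot>\<^sub>v (N *\<^sub>v y t)"
      unfolding A_def using N y[of t]
      by (subst minus_mult_distrib_mat_vec[of _ n n]) (auto simp: smult_mat_mult_vec[OF N y])
    ultimately show ?thesis
      using i N y[of t] by simp
  qed
  have Ny: "(N *\<^sub>v v) $ i \<ge> 0" if "v \<in> carrier_vec n" "\<And>j. j < n \<Longrightarrow> 0 \<le> v $ j" "i < n" for v i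
    unfolding mult_mat_vec_index_sum[OF N that(1,3)] using N0 that by (auto intro!: sum_nonneg)
  have ge1: "y t $ i \<ge> 1" if "t \<in> {0..1}" "\<And>j. j < n \<Longrightarrow> 0 \<le> y t $ j" "i < n" for t i
    using fix_eq[OF that(1,3)] Ny[OF y that(2) that(3)] that(1) by simp
  have ycont: "continuous_on {0..1} (\<lambda>t. y t $ i)" if "i < n" for i
  proof -
    have *: "y t $ i = 1 / det (A t) * (\<Sum>j<n. cofactor (A t) j i)" for t
      using that A[of t] adj_mat(1)[OF A[of t]]
      by (simp add: y_def adj_mat_def mult_mat_vec_index_sum[of _ n n] del: index_mult_mat_vec)
    show ?thesis
      unfolding * using det
      by (intro continuous_intros continuous_on_det[where n = n]
          continuous_on_cofactor[where n = n] A Acont that)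
        (auto simp: A_def)
  qed
  \<comment> \<open>On \<open>U\<close> all entries are at least 1, on \<open>V\<close> some entry
    is at most 0. By \<open>ge1\<close> nothing lies in between, so these two disjoint closed sets
    cover the connected interval [0, 1]; it contains 0, a point of \<open>U\<close>.\<close>
  define U where "U = {0..1::real} \<inter> (\<Inter>i\<in>{..<n}. (\<lambda>t. y t $ i) -` {1..} \<inter> {0..1})"
  define V where "V = (\<Union>i\<in>{..<n}. (\<lambda>t. y t $ i) -` {..0} \<inter> {0..1})"
  have "closed U"
    unfolding U_def by (intro closed_Int[OF closed_atLeastAtMost] closed_INT ballI closed_vimage_Int ycont) auto
  moreover have "closed V"
    unfolding V_def by (intro closed_UN ballI closed_vimage_Int ycont) auto
  moreover have "{0..1} \<subseteq> U \<union> V"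
  proof
    fix t :: real assume t: "t \<in> {0..1}"
    show "t \<in> U \<union> V"
    proof (cases "\<exists>i<n. y t $ i \<le> 0")
      case True
      then show ?thesis
        using t by (auto simp: V_def)
    next
      case False
      then have "1 \<le> y t $ i" if "i < n" for i
        using t that by (intro ge1) (auto simp: not_le less_imp_le)
      then show ?thesis
        using t by (auto simp: U_def)
    qed
  qed
  moreover have "U \<inter> V \<inter> {0..1} = {}"
    unfolding U_def V_def by force
  moreover have "U \<inter> {0..1} \<noteq> {}"
  proof -
    have "y 0 $ i = 1" if "i < n" for i
      using fix_eq[of 0 i] that by simp
    then have "0 \<in> U"
      by (auto simp: U_def)
    then show ?thesis
      by auto
  qed
  ultimately have "V \<inter> {0..1} = {}"
    using connected_Icc[of 0 "1::real"] unfolding connected_closed by blast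
  then have "1 \<notin> V"
    by auto
  with \<open>{0..1} \<subseteq> U \<union> V\<close> have "1 \<in> U"
    by (meson UnE atLeastAtMost_iff order_refl subsetD zero_le_one)
  then have "1 \<le> y 1 $ i" if "i < n" for i
    using that by (auto simp: U_def split: if_splits)
  \<comment> \<open>At \<open>t = 1\<close> the fixed point equation makes
    \<open>N *\<^sub>v y 1\<close> smaller than \<open>y 1\<close> by exactly 1 in every
    entry.\<close>
  then show ?thesis
    using fix_eq[of 1] y[of 1] by (intro bexI[of _ "y 1"]) force+
qed

text \<open>A Collatz-Wielandt comparison. Otherwise there is a positive \<open>y\<close> with
  \<open>N y < y\<close>. Take the least \<open>c\<close> with \<open>x \<le> c y\<close>. At an
  index where equality holds, monotonicity of \<open>N\<close> gives
  \<open>x \<le> N x \<le> c N y < c y = x\<close>.\<close>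

lemma nonneg_subinvariant_imp_singular:
  fixes N :: "real mat"
  assumes N: "N \<in> carrier_mat n n" and N0: "\<And>i j. i < n \<Longrightarrow> j < n \<Longrightarrow> 0 \<le> N $$ (i, j)"
    and x: "x \<in> carrier_vec n" "x \<noteq> 0\<^sub>v n" "\<And>i. i < n \<Longrightarrow> 0 \<le> x $ i"
    and sub: "\<And>i. i < n \<Longrightarrow> x $ i \<le> (N *\<^sub>v x) $ i"
  shows "\<exists>t. 0 \<le> t \<and> t \<le> 1 \<and> det (1\<^sub>m n - t \<cdot>\<^sub>m N) = 0"
proof (rule ccontr)
  assume "\<not> ?thesis"
  then obtain y where y: "y \<in> carrier_vec n" "\<And>i. i < n \<Longrightarrow> 0 < y $ i"
      "\<And>i. i < n \<Longrightarrow> (N *\<^sub>v y) $ i < y $ i"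
    using positive_strict_supersolution[OF N N0] by blast
  define q where "q i = x $ i / y $ i" for i
  obtain k where k: "k < n" "0 < x $ k"
    using x by (metis carrier_vecD eq_vecI index_zero_vec less_eq_real_def)
  \<comment> \<open>The largest ratio is the least multiple of \<open>y\<close> that lies above
    \<open>x\<close>; an index attaining it is the point of contact.\<close>
  define c where "c = Max (q ` {..<n})"
  have c: "x $ i \<le> c * y $ i" if "i < n" for i
  proof -
    have "q i \<le> c"
      unfolding c_def using that by (intro Max_ge) auto
    then show ?thesis
      using y(2)[OF that] by (simp add: q_def field_simps)
  qed
  have "c \<in> q ` {..<n}"
    unfolding c_def using k by (intro Max_in) auto
  then obtain i where i: "i < n" "c = q i"
    by auto
  have "0 < c"
    using c[OF k(1)] k(2) y(2)[OF k(1)] by (smt (verit) mult_nonpos_nonneg)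
  have "x $ i \<le> (N *\<^sub>v x) $ i"
    using sub i by blast
  also have "\<dots> \<le> (\<Sum>j<n. N $$ (i, j) * (c * y $ j))"
    unfolding mult_mat_vec_index_sum[OF N x(1) i(1)]
    using N0 c i by (intro sum_mono mult_left_mono) auto
  also have "\<dots> = c * (N *\<^sub>v y) $ i"
    unfolding mult_mat_vec_index_sum[OF N y(1) i(1)] by (simp add: sum_distrib_left mult_ac)
  also have "\<dots> < c * y $ i"
    using y(3)[OF i(1)] \<open>0 < c\<close> by simp
  also have "\<dots> = x $ i"
    using y(2)[OF i(1)] i by (simp add: q_def)
  finally show False
    by simp
qed

subsection \<open>Spectral norm and gain\<close>

text \<open>Generic in the entries, since complex vectors and their real vectors of moduli are
  measured by the same norm.\<close>

definition vnorm :: "'a :: real_normed_vector vec \<Rightarrow> real" where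
  "vnorm v = L2_set (\<lambda>i. norm (v $ i)) {..<dim_vec v}"

lemma vnorm_nonneg [simp]: "0 \<le> vnorm v"
  by (simp add: vnorm_def)

lemma vnorm_square: "(vnorm v)\<^sup>2 = (\<Sum>i<dim_vec v. (norm (v $ i))\<^sup>2)"
  by (simp add: vnorm_def L2_set_def sum_nonneg)

lemma vnorm_eq_0_iff: "v \<in> carrier_vec n \<Longrightarrow> vnorm v = 0 \<longleftrightarrow> v = 0\<^sub>v n"
  by (auto simp: vnorm_def L2_set_eq_0_iff intro!: eq_vecI)

lemma vnorm_zero [simp]: "vnorm (0\<^sub>v n) = 0"
  by (simp add: vnorm_def L2_set_0')

lemma vnorm_pos: "v \<in> carrier_vec n \<Longrightarrow> v \<noteq> 0\<^sub>v n \<Longrightarrow> 0 < vnorm v"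
  using vnorm_eq_0_iff[of v n] vnorm_nonneg[of v] by linarith

lemma sum_lessThan_add:
  fixes g :: "nat \<Rightarrow> 'a :: comm_monoid_add"
  shows "sum g {..<a + b} = sum g {..<a} + (\<Sum>i<b. g (a + i))"
  by (induction b) (auto simp: add_ac)

lemma vnorm_append: "(vnorm (v @\<^sub>v w))\<^sup>2 = (vnorm v)\<^sup>2 + (vnorm w)\<^sup>2"
proof -
  have "(\<Sum>i<dim_vec v + dim_vec w. (norm ((v @\<^sub>v w) $ i))\<^sup>2) =
      (\<Sum>i<dim_vec v. (norm ((v @\<^sub>v w) $ i))\<^sup>2) +
      (\<Sum>i<dim_vec w. (norm ((v @\<^sub>v w) $ (dim_vec v + i)))\<^sup>2)"
    by (simp add: sum_lessThan_add)
  then show ?thesis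
    by (simp add: vnorm_square)
qed

lemma vnorm_smult:
  fixes c :: "'a :: real_normed_field"
  shows "vnorm (c \<cdot>\<^sub>v v) = norm c * vnorm v"
  by (simp add: vnorm_def norm_mult L2_set_right_distrib cong: L2_set_cong_simp)

lemma vnorm_conjugate: "vnorm (conjugate v) = vnorm (v :: complex vec)"
  by (auto simp: vnorm_def intro!: L2_set_cong)

lemma scalar_prod_le_vnorm:
  fixes v w :: "'a :: real_normed_field vec"
  assumes "v \<in> carrier_vec n" "w \<in> carrier_vec n"
  shows "norm (v \<bullet> w) \<le> vnorm v * vnorm w"
proof -
  have "norm (v \<bullet> w) \<le> (\<Sum>i<n. \<bar>norm (v $ i)\<bar> * \<bar>norm (w $ i)\<bar>)"
    using assms by (auto simp: scalar_prod_def lessThan_atLeast0 norm_mult intro: sum_norm_le)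
  also have "\<dots> \<le> vnorm v * vnorm w"
    using assms L2_set_mult_ineq[of "\<lambda>i. norm (v $ i)" "\<lambda>i. norm (w $ i)" "{..<n}"]
    by (auto simp: vnorm_def)
  finally show ?thesis .
qed

lemma cscalar_prod_self: "(v :: complex vec) \<bullet>c v = of_real ((vnorm v)\<^sup>2)"
  by (auto simp: scalar_prod_def vnorm_square lessThan_atLeast0 complex_norm_square[symmetric] intro!: sum.cong simp del: of_real_power)

section \<open>Adjoints and the Gram matrix\<close>

lemma mat_adjoint_index:
  "i < dim_col A \<Longrightarrow> j < dim_row A \<Longrightarrow> mat_adjoint A $$ (i, j) = conjugate (A $$ (j, i))"
  by (simp add: mat_adjoint_def mat_of_rows_index)

lemma mat_adjoint_carrier: "A \<in> carrier_mat n k \<Longrightarrow> mat_adjoint A \<in> carrier_mat k n"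
  by (auto simp: mat_adjoint_def)

lemma cscalar_prod_mat_adjoint:
  fixes A :: "complex mat"
  assumes "A \<in> carrier_mat n k" "v \<in> carrier_vec k" "w \<in> carrier_vec n"
  shows "(A *\<^sub>v v) \<bullet>c w = v \<bullet>c (mat_adjoint A *\<^sub>v w)"
proof -
  have "(A *\<^sub>v v) \<bullet>c w = (\<Sum>i<n. \<Sum>j<k. A $$ (i, j) * v $ j * cnj (w $ i))"
    using assms by (auto simp: scalar_prod_def lessThan_atLeast0 sum_distrib_right intro!: sum.cong)
  also have "\<dots> = (\<Sum>j<k. \<Sum>i<n. A $$ (i, j) * v $ j * cnj (w $ i))"
    by (rule sum.swap)
  also have "\<dots> = v \<bullet>c (mat_adjoint A *\<^sub>v w)"
    using assms mat_adjoint_carrier[OF assms(1)]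
    by (auto simp: scalar_prod_def lessThan_atLeast0 sum_distrib_left mat_adjoint_index mult_ac
        intro!: sum.cong)
  finally show ?thesis .
qed

lemma vnorm_mult_square:
  fixes A :: "complex mat"
  assumes "A \<in> carrier_mat n k" "v \<in> carrier_vec k"
  shows "of_real ((vnorm (A *\<^sub>v v))\<^sup>2) = v \<bullet>c ((mat_adjoint A * A) *\<^sub>v v)"
proof -
  have "of_real ((vnorm (A *\<^sub>v v))\<^sup>2) = v \<bullet>c (mat_adjoint A *\<^sub>v (A *\<^sub>v v))"
    using assms by (subst cscalar_prod_mat_adjoint[symmetric, OF assms]) (auto simp: cscalar_prod_self)
  then show ?thesis
    using assms mat_adjoint_carrier[OF assms(1)] by simp
qed

text \<open>Rayleigh quotient: pairing an eigenvector \<open>v\<close> with its image gives both the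
  squared length of \<open>A v\<close> and the conjugate of \<open>l\<close> times the squared
  length of \<open>v\<close>. So every eigenvalue is real, nonnegative and the squared gain of
  \<open>A\<close> on some vector.\<close>

lemma eigenvalue_gram_matrix:
  fixes A :: "complex mat"
  assumes A: "A \<in> carrier_mat n k" and "eigenvalue (mat_adjoint A * A) l"
  shows "\<exists>v \<in> carrier_vec k. v \<noteq> 0\<^sub>v k \<and> l = of_real ((vnorm (A *\<^sub>v v) / vnorm v)\<^sup>2)"
proof -
  have B: "mat_adjoint A * A \<in> carrier_mat k k"
    using A mat_adjoint_carrier[OF A] by simp
  obtain v where v: "v \<in> carrier_vec k" "v \<noteq> 0\<^sub>v k" "(mat_adjoint A * A) *\<^sub>v v = l \<cdot>\<^sub>v v"
    using assms(2) B unfolding eigenvalue_def eigenvector_def by auto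
  have "of_real ((vnorm (A *\<^sub>v v))\<^sup>2) = v \<bullet>c (l \<cdot>\<^sub>v v)"
    using vnorm_mult_square[OF A v(1)] v(3) by simp
  also have "\<dots> = cnj l * of_real ((vnorm v)\<^sup>2)"
    using v(1) by (simp add: conjugate_smult_vec cscalar_prod_self)
  finally have "cnj l = of_real ((vnorm (A *\<^sub>v v))\<^sup>2) / of_real ((vnorm v)\<^sup>2)"
    using vnorm_pos[OF v(1,2)] by (simp add: field_simps)
  then have "cnj l = of_real ((vnorm (A *\<^sub>v v) / vnorm v)\<^sup>2)"
    by (simp add: power_divide)
  then have "l = of_real ((vnorm (A *\<^sub>v v) / vnorm v)\<^sup>2)"
    by (metis complex_cnj_cnj complex_cnj_complex_of_real)
  with v show ?thesis
    by blast
qed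

text \<open>An upper bound for the operator norm. Unlike the eigenvalues of the Gram matrix, it
  passes easily to blocks and to scalings; \<open>spectral_norm_le\<close> and
  \<open>gain_le_spectral_norm\<close> translate between the two.\<close>

definition gain_le :: "complex mat \<Rightarrow> real \<Rightarrow> bool" where
  "gain_le A r \<longleftrightarrow> (\<forall>v \<in> carrier_vec (dim_col A). vnorm (A *\<^sub>v v) \<le> r * vnorm v)"

lemma gain_leD: "gain_le A r \<Longrightarrow> A \<in> carrier_mat n k \<Longrightarrow> v \<in> carrier_vec k \<Longrightarrow> vnorm (A *\<^sub>v v) \<le> r * vnorm v"
  by (auto simp: gain_le_def)

lemma singular_values_finite_nonempty:
  assumes "A \<in> carrier_mat n k" "0 < k"
  shows "finite (singular_values A)" "singular_values A \<noteq> {}"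
proof -
  have B: "mat_adjoint A * A \<in> carrier_mat k k"
    using assms mat_adjoint_carrier[OF assms(1)] by simp
  show "finite (singular_values A)" "singular_values A \<noteq> {}"
    unfolding singular_values_def
    using card_finite_spectrum(1)[OF B] spectrum_non_empty[OF B assms(2)] by auto
qed

text \<open>Each singular value is the gain of \<open>A\<close> on one particular vector. The
  assumption on \<open>r\<close> covers a matrix without columns, whose norm is 0 by
  definition.\<close>

lemma spectral_norm_le:
  assumes A: "A \<in> carrier_mat n k" and gain: "gain_le A r" and r: "0 \<le> r"
  shows "spectral_norm A \<le> r"
proof (cases "k = 0")
  case True
  then show ?thesis
    using A r by (simp add: spectral_norm_def)
next
  case False
  have "s \<le> r" if s: "s \<in> singular_values A" for s
  proof -
    obtain l where l: "eigenvalue (mat_adjoint A * A) l" "s = sqrt (Re l)"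
      using s by (auto simp: singular_values_def spectrum_def)
    obtain v where v: "v \<in> carrier_vec k" "v \<noteq> 0\<^sub>v k"
        and "l = of_real ((vnorm (A *\<^sub>v v) / vnorm v)\<^sup>2)"
      using eigenvalue_gram_matrix[OF A l(1)] by blast
    then have "s = vnorm (A *\<^sub>v v) / vnorm v"
      using l(2) by simp
    then show ?thesis
      using gain_leD[OF gain A v(1)] vnorm_pos[OF v] by (simp add: divide_le_eq)
  qed
  then show ?thesis
    using False A singular_values_finite_nonempty[OF A] by (simp add: spectral_norm_def)
qed

lemma spectral_norm_nonneg:
  assumes A: "A \<in> carrier_mat n k"
  shows "0 \<le> spectral_norm A"
proof (cases "k = 0")
  case True
  then show ?thesis
    using A by (simp add: spectral_norm_def)
next
  case False
  then have "Max (singular_values A) \<in> singular_values A"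
    using singular_values_finite_nonempty[OF A] by (intro Max_in) auto
  then obtain l where "eigenvalue (mat_adjoint A * A) l" "Max (singular_values A) = sqrt (Re l)"
    by (auto simp: singular_values_def spectrum_def)
  then have "0 \<le> Max (singular_values A)"
    using eigenvalue_gram_matrix[OF A] by fastforce
  then show ?thesis
    by (simp add: spectral_norm_def)
qed

lemma pow_mat_add_mult_vec:
  fixes A :: "'a :: comm_ring_1 mat"
  assumes A: "A \<in> carrier_mat n n"
  shows "v \<in> carrier_vec n \<Longrightarrow> A ^\<^sub>m (i + j) *\<^sub>v v = A ^\<^sub>m i *\<^sub>v (A ^\<^sub>m j *\<^sub>v v)"
proof (induction j arbitrary: v)
  case 0
  then show ?case
    using A by simp
next
  case (Suc j)
  then have "A ^\<^sub>m (i + Suc j) *\<^sub>v v = A ^\<^sub>m (i + j) *\<^sub>v (A *\<^sub>v v)"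
    using A pow_carrier_mat[OF A, of "i + j"] by (simp add: assoc_mult_mat_vec[of _ n n _ n])
  also have "\<dots> = A ^\<^sub>m i *\<^sub>v (A ^\<^sub>m j *\<^sub>v (A *\<^sub>v v))"
    using Suc A by (intro Suc.IH) auto
  also have "A ^\<^sub>m j *\<^sub>v (A *\<^sub>v v) = A ^\<^sub>m Suc j *\<^sub>v v"
    using Suc A pow_carrier_mat[OF A, of j] by (simp add: assoc_mult_mat_vec[of _ n n _ n])
  finally show ?case .
qed

text \<open>Cauchy-Schwarz gives \<open>\<parallel>C\<^sup>j v\<parallel>\<^sup>2 \<le> \<parallel>v\<parallel> \<parallel>C\<^sup>2\<^sup>j v\<parallel>\<close>, so if \<open>\<parallel>C v\<parallel> = a \<parallel>v\<parallel>\<close> with \<open>a > 1\<close>, then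
  \<open>\<parallel>C\<^sup>j v\<parallel> \<ge> a\<^sup>j \<parallel>v\<parallel>\<close> for all powers \<open>j\<close> of 2, contradicting that the powers of \<open>C\<close> are bounded.\<close>

lemma self_adjoint_spectral_radius_less_1:
  fixes C :: "complex mat"
  assumes C: "C \<in> carrier_mat k k"
    and adj: "\<And>v w. v \<in> carrier_vec k \<Longrightarrow> w \<in> carrier_vec k \<Longrightarrow> (C *\<^sub>v v) \<bullet>c w = v \<bullet>c (C *\<^sub>v w)"
    and rad: "spectral_radius C < 1"
    and v: "v \<in> carrier_vec k"
  shows "vnorm (C *\<^sub>v v) \<le> vnorm v"
proof (rule ccontr)
  assume less: "\<not> ?thesis"
  have pow: "C ^\<^sub>m j \<in> carrier_mat k k" for j
    using C by (rule pow_carrier_mat)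
  have pow_adj: "(C ^\<^sub>m j *\<^sub>v u) \<bullet>c w = u \<bullet>c (C ^\<^sub>m j *\<^sub>v w)"
    if "u \<in> carrier_vec k" "w \<in> carrier_vec k" for j u w
    using that
  proof (induction j arbitrary: u w)
    case 0
    then show ?case
      using C by simp
  next
    case (Suc j)
    have "(C ^\<^sub>m Suc j *\<^sub>v u) \<bullet>c w = (C *\<^sub>v u) \<bullet>c (C ^\<^sub>m j *\<^sub>v w)"
      using Suc C pow[of j] by (simp add: assoc_mult_mat_vec[of _ k k _ k])
    also have "\<dots> = u \<bullet>c (C *\<^sub>v (C ^\<^sub>m j *\<^sub>v w))"
      using Suc.prems pow[of j] by (intro adj) auto
    \<comment> \<open>The recursion of \<open>^\<^sub>m\<close> puts the new factor on the right,
      but it now stands on the left; the exponent \<open>1 + j\<close> moves it.\<close>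
    also have "C *\<^sub>v (C ^\<^sub>m j *\<^sub>v w) = C ^\<^sub>m Suc j *\<^sub>v w"
      using pow_mat_add_mult_vec[OF C Suc.prems(2), of 1 j] C by simp
    finally show ?case .
  qed
  \<comment> \<open>Spectral radius below 1 yields one bound for all entries of all powers, hence
    the bound \<open>K\<close> for the whole orbit of \<open>v\<close>.\<close>
  obtain b where b: "\<And>j. norm_bound (C ^\<^sub>m j) b"
    using spectral_radius_jnf_norm_bound_less_1_upper_triangular[OF C rad] by blast
  define K where "K = (\<Sum>i<k. \<Sum>j<k. b * cmod (v $ j))"
  have K: "vnorm (C ^\<^sub>m j *\<^sub>v v) \<le> K" for j
  proof -
    have "vnorm (C ^\<^sub>m j *\<^sub>v v) \<le> (\<Sum>i<k. cmod ((C ^\<^sub>m j *\<^sub>v v) $ i))"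
      unfolding vnorm_def using pow[of j] by (intro order_trans[OF L2_set_le_sum]) auto
    also have "\<dots> \<le> K"
      unfolding K_def
    proof (intro sum_mono)
      fix i assume i: "i \<in> {..<k}"
      have "cmod (\<Sum>l<k. (C ^\<^sub>m j) $$ (i, l) * v $ l) \<le> (\<Sum>l<k. b * cmod (v $ l))"
        using b[of j] i carrier_matD[OF pow[of j]]
        by (intro sum_norm_le) (auto simp del: pow_mat_dim simp: norm_mult norm_bound_def intro!: mult_right_mono)
      then show "cmod ((C ^\<^sub>m j *\<^sub>v v) $ i) \<le> (\<Sum>l<k. b * cmod (v $ l))"
        using i by (simp add: mult_mat_vec_index_sum[OF pow v] del: index_mult_mat_vec)
    qed
    finally show ?thesis .
  qed
  have v0: "v \<noteq> 0\<^sub>v k"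
  proof
    assume "v = 0\<^sub>v k"
    moreover have "C *\<^sub>v 0\<^sub>v k = 0\<^sub>v k"
      using C by (auto intro!: eq_vecI)
    ultimately show False
      using less by simp
  qed
  define a where "a = vnorm (C *\<^sub>v v) / vnorm v"
  have a: "1 < a"
    using less vnorm_pos[OF v v0] by (simp add: a_def)
  have grow: "a ^ (2 ^ j) * vnorm v \<le> vnorm (C ^\<^sub>m (2 ^ j) *\<^sub>v v)" for j
  proof (induction j)
    case 0
    then show ?case
      using vnorm_pos[OF v v0] C by (simp add: a_def)
  next
    case (Suc j)
    have "(a ^ (2 ^ j) * vnorm v)\<^sup>2 \<le> (vnorm (C ^\<^sub>m (2 ^ j) *\<^sub>v v))\<^sup>2"
      using Suc a by (intro power_mono) auto
    also have "\<dots> = cmod ((C ^\<^sub>m (2 ^ j) *\<^sub>v v) \<bullet>c (C ^\<^sub>m (2 ^ j) *\<^sub>v v))"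
      unfolding cscalar_prod_self by (simp add: norm_power)
    also have "(C ^\<^sub>m (2 ^ j) *\<^sub>v v) \<bullet>c (C ^\<^sub>m (2 ^ j) *\<^sub>v v) = v \<bullet>c (C ^\<^sub>m (2 ^ j) *\<^sub>v (C ^\<^sub>m (2 ^ j) *\<^sub>v v))"
      using v pow by (intro pow_adj) (auto intro: mult_mat_vec_carrier)
    also have "C ^\<^sub>m (2 ^ j) *\<^sub>v (C ^\<^sub>m (2 ^ j) *\<^sub>v v) = C ^\<^sub>m (2 ^ Suc j) *\<^sub>v v"
      using pow_mat_add_mult_vec[OF C v, of "2 ^ j" "2 ^ j"] by (simp add: mult_2)
    also have "cmod (v \<bullet>c (C ^\<^sub>m (2 ^ Suc j) *\<^sub>v v)) \<le> vnorm v * vnorm (C ^\<^sub>m (2 ^ Suc j) *\<^sub>v v)"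
      using scalar_prod_le_vnorm[of v k "conjugate (C ^\<^sub>m (2 ^ Suc j) *\<^sub>v v)"] v pow[of "2 ^ Suc j"]
      by (simp add: vnorm_conjugate)
    finally have "vnorm v * (a ^ (2 ^ Suc j) * vnorm v) \<le> vnorm v * vnorm (C ^\<^sub>m (2 ^ Suc j) *\<^sub>v v)"
      by (simp add: power_mult_distrib power2_eq_square power_mult[symmetric] power_add[symmetric] mult_ac mult_2[symmetric])
    then show ?case
      using vnorm_pos[OF v v0] by simp
  qed
  obtain j where j: "K / vnorm v < a ^ j"
    using real_arch_pow[OF a] by blast
  have "K < a ^ j * vnorm v"
    using j vnorm_pos[OF v v0] by (simp add: field_simps)
  \<comment> \<open>The growth is known only along powers of 2; since \<open>j < 2 ^ j\<close> and
    \<open>a > 1\<close>, this suffices.\<close>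
  also have "\<dots> \<le> a ^ (2 ^ j) * vnorm v"
    using a by (intro mult_right_mono power_increasing) (auto intro: less_imp_le less_exp)
  also have "\<dots> \<le> K"
    using grow K by (rule order_trans)
  finally show False
    by simp
qed

text \<open>For \<open>c > s\<^sup>2\<close> the self-adjoint matrix \<open>C = B / c\<close> has
  spectral radius below 1, so it does not lengthen vectors. By Cauchy-Schwarz the squared length of
  \<open>A v\<close>, which is the pairing of \<open>v\<close> with \<open>B v\<close>, is then at
  most \<open>c\<close> times that of \<open>v\<close>. Strictness of \<open>c\<close> makes the
  radius bound strict; it is removed at the end by a limit.\<close>

lemma gain_le_spectral_norm:
  assumes A: "A \<in> carrier_mat n k"
  shows "gain_le A (spectral_norm A)"
proof (cases "k = 0")
  case True
  then show ?thesis
    using A by (auto simp: gain_le_def vnorm_def L2_set_def scalar_prod_def)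
next
  case False
  define s where "s = spectral_norm A"
  define B where "B = mat_adjoint A * A"
  have B: "B \<in> carrier_mat k k"
    using A mat_adjoint_carrier[OF A] by (simp add: B_def)
  have B_adj: "(B *\<^sub>v v) \<bullet>c w = v \<bullet>c (B *\<^sub>v w)" if "v \<in> carrier_vec k" "w \<in> carrier_vec k" for v w
  proof -
    have "(A *\<^sub>v v) \<bullet>c (A *\<^sub>v w) = v \<bullet>c (B *\<^sub>v w)"
      unfolding B_def using that A mat_adjoint_carrier[OF A]
      by (subst cscalar_prod_mat_adjoint[OF A that(1)]) auto
    moreover have "(A *\<^sub>v w) \<bullet>c (A *\<^sub>v v) = w \<bullet>c (B *\<^sub>v v)"
      unfolding B_def using that A mat_adjoint_carrier[OF A]
      by (subst cscalar_prod_mat_adjoint[OF A that(2)]) auto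
    moreover have "cnj ((A *\<^sub>v w) \<bullet>c (A *\<^sub>v v)) = (A *\<^sub>v v) \<bullet>c (A *\<^sub>v w)"
      using A by (simp add: scalar_prod_def mult.commute)
    moreover have "cnj (w \<bullet>c (B *\<^sub>v v)) = (B *\<^sub>v v) \<bullet>c w"
      using B that by (simp add: scalar_prod_def mult.commute)
    ultimately show ?thesis
      by metis
  qed
  have bound: "(vnorm (A *\<^sub>v v))\<^sup>2 \<le> c * (vnorm v)\<^sup>2" if c: "s\<^sup>2 < c" and v: "v \<in> carrier_vec k" for c v
  proof -
    have c0: "0 < c"
      using c by (smt (verit) zero_le_power2)
    define C where "C = of_real (1 / c) \<cdot>\<^sub>m B"
    have C: "C \<in> carrier_mat k k"
      using B by (simp add: C_def)
    have Cv: "C *\<^sub>v u = of_real (1 / c) \<cdot>\<^sub>v (B *\<^sub>v u)" if "u \<in> carrier_vec k" for u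
      unfolding C_def using smult_mat_mult_vec[OF B that] .
    \<comment> \<open>Multiplied by \<open>c\<close>, an eigenvalue of \<open>C\<close> becomes one
      of \<open>B\<close>, whose square root is a singular value of \<open>A\<close> and so at most
      \<open>s\<close>.\<close>
    have "cmod l < 1" if l: "eigenvalue C l" for l
    proof -
      obtain u where u: "u \<in> carrier_vec k" "u \<noteq> 0\<^sub>v k" "C *\<^sub>v u = l \<cdot>\<^sub>v u"
        using l C unfolding eigenvalue_def eigenvector_def by auto
      have "B *\<^sub>v u = of_real c \<cdot>\<^sub>v (C *\<^sub>v u)"
        unfolding Cv[OF u(1)] using c0 by (simp add: smult_smult_assoc)
      then have "B *\<^sub>v u = (of_real c * l) \<cdot>\<^sub>v u"
        unfolding u(3) by (simp add: smult_smult_assoc)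
      then have ev: "eigenvalue B (of_real c * l)"
        using u B unfolding eigenvalue_def eigenvector_def by auto
      then obtain w where w: "of_real c * l = of_real ((vnorm (A *\<^sub>v w) / vnorm w)\<^sup>2)"
        using eigenvalue_gram_matrix[OF A] unfolding B_def by blast
      have "sqrt (Re (of_real c * l)) \<in> singular_values A"
        unfolding singular_values_def spectrum_def
        using ev[unfolded B_def] by (intro imageI) simp
      then have "sqrt (Re (of_real c * l)) \<le> s"
        unfolding s_def spectral_norm_def
        using False A singular_values_finite_nonempty[OF A] by auto
      then have "vnorm (A *\<^sub>v w) / vnorm w \<le> s"
        unfolding w by simp
      then have "(vnorm (A *\<^sub>v w) / vnorm w)\<^sup>2 \<le> s\<^sup>2"
        by (intro power_mono) auto
      moreover have "c * cmod l = (vnorm (A *\<^sub>v w) / vnorm w)\<^sup>2"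
        using arg_cong[OF w, of cmod] c0 by (simp add: norm_mult norm_power norm_divide)
      ultimately have "c * cmod l < c * 1"
        using c by simp
      then show ?thesis
        using c0 by simp
    qed
    then have "spectral_radius C < 1"
      using spectral_radius_mem_max(1)[OF C] False by (auto simp: spectrum_def)
    moreover have "(C *\<^sub>v u) \<bullet>c w = u \<bullet>c (C *\<^sub>v w)" if "u \<in> carrier_vec k" "w \<in> carrier_vec k" for u w
    proof -
      have "(C *\<^sub>v u) \<bullet>c w = of_real (1 / c) * ((B *\<^sub>v u) \<bullet>c w)"
        unfolding Cv[OF that(1)] using B that by simp
      also have "\<dots> = of_real (1 / c) * (u \<bullet>c (B *\<^sub>v w))"
        using B_adj[OF that] by simp
      also have "\<dots> = u \<bullet>c (C *\<^sub>v w)"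
        unfolding Cv[OF that(2)] using B that by (simp add: conjugate_smult_vec)
      finally show ?thesis .
    qed
    ultimately have "vnorm (C *\<^sub>v v) \<le> vnorm v"
      using self_adjoint_spectral_radius_less_1[OF C _ _ v] by blast
    then have Bv: "vnorm (B *\<^sub>v v) \<le> c * vnorm v"
      unfolding Cv[OF v] vnorm_smult using c0 by (simp add: field_simps norm_divide)
    have "(vnorm (A *\<^sub>v v))\<^sup>2 = cmod (v \<bullet>c (B *\<^sub>v v))"
      using vnorm_mult_square[OF A v] unfolding B_def[symmetric]
      by (metis abs_of_nonneg norm_of_real zero_le_power2)
    also have "\<dots> \<le> vnorm v * vnorm (B *\<^sub>v v)"
      using scalar_prod_le_vnorm[of v k "conjugate (B *\<^sub>v v)"] v B by (simp add: vnorm_conjugate)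
    also have "\<dots> \<le> vnorm v * (c * vnorm v)"
      using Bv by (intro mult_left_mono) auto
    finally show ?thesis
      by (simp add: power2_eq_square mult_ac)
  qed
  have "vnorm (A *\<^sub>v v) \<le> s * vnorm v" if v: "v \<in> carrier_vec k" for v
  proof -
    have "(vnorm (A *\<^sub>v v))\<^sup>2 \<le> s\<^sup>2 * (vnorm v)\<^sup>2"
    proof (cases "vnorm v = 0")
      case True
      then show ?thesis
        \<comment> \<open>Any admissible \<open>c\<close> makes the right-hand side 0 here;
          \<open>s\<^sup>2 + 1\<close> is one.\<close>
        using bound[of "s\<^sup>2 + 1" v] v by simp
    next
      case False
      then have pos: "0 < (vnorm v)\<^sup>2"
        by simp
      \<comment> \<open>Let \<open>c\<close> decrease to \<open>s\<^sup>2\<close>.\<close>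
      have "(vnorm (A *\<^sub>v v))\<^sup>2 / (vnorm v)\<^sup>2 \<le> s\<^sup>2"
      proof (rule dense_ge)
        show "(vnorm (A *\<^sub>v v))\<^sup>2 / (vnorm v)\<^sup>2 \<le> c" if "s\<^sup>2 < c" for c
          using bound[OF that v] pos by (simp add: divide_le_eq)
      qed
      then show ?thesis
        using pos by (simp add: divide_le_eq)
    qed
    then have "(vnorm (A *\<^sub>v v))\<^sup>2 \<le> (s * vnorm v)\<^sup>2"
      by (simp add: power_mult_distrib)
    then show ?thesis
      by (rule power2_le_imp_le) (simp add: s_def spectral_norm_nonneg[OF A])
  qed
  then show ?thesis
    using A by (auto simp: gain_le_def s_def)
qed

subsection \<open>Block diagonal matrices\<close>

text \<open>The two-block case of \<open>diag_block_mat\<close>. Both list constructors and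
  \<open>@\<close> reduce to it, so facts about two blocks extend by induction.\<close>

definition block_diag :: "'a :: zero mat \<Rightarrow> 'a mat \<Rightarrow> 'a mat" where
  "block_diag A D = four_block_mat A (0\<^sub>m (dim_row A) (dim_col D)) (0\<^sub>m (dim_row D) (dim_col A)) D"

lemma diag_block_mat_Cons': "diag_block_mat (A # As) = block_diag A (diag_block_mat As)"
  by (simp add: block_diag_def Let_def)

lemma diag_block_mat_append': "diag_block_mat (As @ Bs) = block_diag (diag_block_mat As) (diag_block_mat Bs)"
  by (simp add: diag_block_mat_append block_diag_def Let_def)

lemma block_diag_carrier [intro]:
  "A \<in> carrier_mat n n \<Longrightarrow> D \<in> carrier_mat k k \<Longrightarrow> block_diag A D \<in> carrier_mat (n + k) (n + k)"
  by (simp add: block_diag_def)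

lemma block_diag_mult_vec:
  assumes "A \<in> carrier_mat n n" "D \<in> carrier_mat k k" "v \<in> carrier_vec n" "w \<in> carrier_vec k"
  shows "block_diag A D *\<^sub>v (v @\<^sub>v w) = (A *\<^sub>v v) @\<^sub>v (D *\<^sub>v w)"
  using mult_mat_vec_split[OF assms] assms by (simp add: block_diag_def)

lemma smult_block_diag:
  fixes c :: "'a :: semiring_0"
  shows "c \<cdot>\<^sub>m block_diag A D = block_diag (c \<cdot>\<^sub>m A) (c \<cdot>\<^sub>m D)"
  by (rule eq_matI) (auto simp: block_diag_def)

lemma map_block_diag: "f 0 = 0 \<Longrightarrow> map_mat f (block_diag A D) = block_diag (map_mat f A) (map_mat f D)"
  by (rule eq_matI) (auto simp: block_diag_def)

lemma elements_block_diag_nonneg: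
  assumes "elements_mat A \<subseteq> {0 :: real..}" "elements_mat D \<subseteq> {0..}"
  shows "elements_mat (block_diag A D) \<subseteq> {0..}"
proof -
  have "elements_mat (block_diag A D) \<subseteq> elements_mat A \<union>
      elements_mat (0\<^sub>m (dim_row A) (dim_col D)) \<union> elements_mat (0\<^sub>m (dim_row D) (dim_col A)) \<union> elements_mat D"
    unfolding block_diag_def by (rule elements_four_block_mat) auto
  also have "\<dots> \<subseteq> {0..}"
    using assms order_trans[OF elements_0_mat, of "{0 :: real..}"] by auto
  finally show ?thesis .
qed

lemma vnorm_append_le:
  assumes "0 \<le> r" "vnorm a \<le> r * vnorm v" "vnorm b \<le> r * vnorm w"
  shows "vnorm (a @\<^sub>v b) \<le> r * vnorm (v @\<^sub>v w)"
proof -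
  have "(vnorm a)\<^sup>2 \<le> (r * vnorm v)\<^sup>2" "(vnorm b)\<^sup>2 \<le> (r * vnorm w)\<^sup>2"
    using assms by (auto intro: power_mono)
  then have "(vnorm (a @\<^sub>v b))\<^sup>2 \<le> (r * vnorm (v @\<^sub>v w))\<^sup>2"
    by (simp add: power_mult_distrib vnorm_append algebra_simps)
  then show ?thesis
    by (rule power2_le_imp_le) (simp add: assms(1))
qed

lemma vnorm_append_zero:
  "vnorm (v @\<^sub>v 0\<^sub>v n) = vnorm v" "vnorm (0\<^sub>v n @\<^sub>v v) = vnorm v"
  using vnorm_append[of v "0\<^sub>v n"] vnorm_append[of "0\<^sub>v n" v] by (simp_all add: power2_eq_iff_nonneg)

text \<open>The norm of a block diagonal matrix is the maximum over its blocks: vectors padded by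
  zeros see a single block, and Pythagoras combines the bounds of both.\<close>

lemma gain_le_block_diag:
  assumes A: "A \<in> carrier_mat n n" and D: "D \<in> carrier_mat k k" and r: "0 \<le> r"
  shows "gain_le (block_diag A D) r \<longleftrightarrow> gain_le A r \<and> gain_le D r"
proof (intro iffI conjI)
  assume gain: "gain_le (block_diag A D) r"
  have *: "vnorm ((A *\<^sub>v v) @\<^sub>v (D *\<^sub>v w)) \<le> r * vnorm (v @\<^sub>v w)"
    if "v \<in> carrier_vec n" "w \<in> carrier_vec k" for v w
    using gain_leD[OF gain block_diag_carrier[OF A D], of "v @\<^sub>v w"] that block_diag_mult_vec[OF A D that]
    by simp
  have zero: "A *\<^sub>v 0\<^sub>v n = 0\<^sub>v n" "D *\<^sub>v 0\<^sub>v k = 0\<^sub>v k"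
    using A D by (auto intro!: eq_vecI)
  show "gain_le A r"
    unfolding gain_le_def using *[of _ "0\<^sub>v k"] A by (auto simp: zero vnorm_append_zero)
  show "gain_le D r"
    unfolding gain_le_def using *[of "0\<^sub>v n"] D by (auto simp: zero vnorm_append_zero)
next
  assume "gain_le A r \<and> gain_le D r"
  then have "vnorm (block_diag A D *\<^sub>v (v @\<^sub>v w)) \<le> r * vnorm (v @\<^sub>v w)"
    if "v \<in> carrier_vec n" "w \<in> carrier_vec k" for v w
    unfolding block_diag_mult_vec[OF A D that]
    using that A D r by (intro vnorm_append_le) (auto simp: gain_le_def)
  moreover have "dim_col (block_diag A D) = n + k"
    using block_diag_carrier[OF A D] by auto
  ultimately show "gain_le (block_diag A D) r"
    unfolding gain_le_def by (simp add: all_vec_append)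
qed

lemma diag_block_mat_carrier:
  assumes "\<And>i. i \<in> set is \<Longrightarrow> B i \<in> carrier_mat (n i) (n i)"
  shows "diag_block_mat (map B is) \<in> carrier_mat (sum_list (map n is)) (sum_list (map n is))"
  using diag_block_mat_blocks_carrier[of "is" B n "[]"] assms by simp

lemma gain_le_diag_block_mat:
  assumes "\<And>i. i \<in> set is \<Longrightarrow> B i \<in> carrier_mat (n i) (n i)" and "0 \<le> r"
  shows "gain_le (diag_block_mat (map B is)) r \<longleftrightarrow> (\<forall>i \<in> set is. gain_le (B i) r)"
  using assms(1)
proof (induction "is")
  case Nil
  then show ?case
    by (simp add: gain_le_def vnorm_def)
next
  case (Cons i "is")
  then show ?case
    using gain_le_block_diag[OF Cons.prems diag_block_mat_carrier[of "is" B n] assms(2), of i]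
    by (simp add: diag_block_mat_Cons' del: diag_block_mat.simps(2))
qed

lemma elements_diag_block_mat_nonneg:
  "(\<And>i. i \<in> set is \<Longrightarrow> elements_mat (B i) \<subseteq> {0 :: real..}) \<Longrightarrow>
    elements_mat (diag_block_mat (map B is)) \<subseteq> {0..}"
proof (induction "is")
  case Nil
  then show ?case
    by (auto dest!: elements_matD)
next
  case (Cons i "is")
  then show ?case
    unfolding list.map diag_block_mat_Cons' by (intro elements_block_diag_nonneg) auto
qed

lemma smult_diag_block_mat:
  fixes c :: "'a :: semiring_0"
  shows "c \<cdot>\<^sub>m diag_block_mat (map B is) = diag_block_mat (map (\<lambda>i. c \<cdot>\<^sub>m B i) is)"
  by (induction "is") (auto simp: diag_block_mat_Cons' smult_block_diag simp del: diag_block_mat.simps(2) intro: eq_matI)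

lemma map_diag_block_mat:
  "f 0 = 0 \<Longrightarrow> map_mat f (diag_block_mat (map B is)) = diag_block_mat (map (\<lambda>i. map_mat f (B i)) is)"
  by (induction "is") (auto simp: diag_block_mat_Cons' map_block_diag simp del: diag_block_mat.simps(2) intro: eq_matI)

section \<open>Diagonal matrices and scalar blocks\<close>

lemma dim_mat_diag [simp]: "dim_row (mat_diag n d) = n" "dim_col (mat_diag n d) = n"
  by (simp_all add: mat_diag_def)

lemma map_mat_diag: "f 0 = 0 \<Longrightarrow> map_mat f (mat_diag n d) = mat_diag n (\<lambda>i. f (d i))"
  by (rule eq_matI) (auto simp: mat_diag_def)

lemma smult_mat_diag: "c \<cdot>\<^sub>m mat_diag n d = mat_diag n (\<lambda>i. c * d i :: 'a :: semiring_0)"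
  by (rule eq_matI) (auto simp: mat_diag_def)

lemma mat_diag_mult_vec_index:
  fixes d :: "nat \<Rightarrow> 'a :: semiring_0"
  assumes "v \<in> carrier_vec n" "i < n"
  shows "(mat_diag n d *\<^sub>v v) $ i = d i * v $ i"
proof -
  have "(mat_diag n d *\<^sub>v v) $ i = (\<Sum>j<n. if j = i then d i * v $ i else 0)"
    unfolding mult_mat_vec_index_sum[OF mat_diag_dim assms]
    using assms by (intro sum.cong) (auto simp: mat_diag_def)
  then show ?thesis
    using assms by simp
qed

text \<open>The image of the \<open>i\<close>-th unit vector has length \<open>cmod (d i)\<close>;
  conversely the entries of a vector are scaled separately.\<close>

lemma gain_le_mat_diag:
  assumes "0 \<le> r"
  shows "gain_le (mat_diag n d) r \<longleftrightarrow> (\<forall>i<n. cmod (d i) \<le> r)"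
proof (intro iffI allI impI)
  fix i assume gain: "gain_le (mat_diag n d) r" and i: "i < n"
  have "vnorm (unit_vec n i :: complex vec) = L2_set (\<lambda>j. if j = i then 1 else 0) {..<n}"
    using i by (auto simp: vnorm_def unit_vec_def intro!: L2_set_cong)
  also have "\<dots> = 1"
    using i by (simp add: L2_set_def if_distrib[of "\<lambda>x. x\<^sup>2"] cong: if_cong)
  finally have "vnorm (mat_diag n d *\<^sub>v unit_vec n i) \<le> r"
    using gain_leD[OF gain mat_diag_dim, of "unit_vec n i"] by simp
  moreover have "cmod ((mat_diag n d *\<^sub>v unit_vec n i) $ i) \<le> vnorm (mat_diag n d *\<^sub>v unit_vec n i)"
    unfolding vnorm_def using i
    by (intro member_le_L2_set) (auto simp: mat_diag_def)
  ultimately show "cmod (d i) \<le> r"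
    using i by (simp add: mat_diag_mult_vec_index del: index_mult_mat_vec)
next
  assume d: "\<forall>i<n. cmod (d i) \<le> r"
  have "vnorm (mat_diag n d *\<^sub>v v) \<le> r * vnorm v" if v: "v \<in> carrier_vec n" for v
  proof -
    have "vnorm (mat_diag n d *\<^sub>v v) = L2_set (\<lambda>i. cmod (d i) * cmod (v $ i)) {..<n}"
      using v by (auto simp: vnorm_def mat_diag_mult_vec_index norm_mult simp del: index_mult_mat_vec intro!: L2_set_cong)
    also have "\<dots> \<le> L2_set (\<lambda>i. r * cmod (v $ i)) {..<n}"
      using d by (intro L2_set_mono mult_right_mono) auto
    also have "\<dots> = r * vnorm v"
      using v assms by (simp add: vnorm_def L2_set_right_distrib)
    finally show ?thesis .
  qed
  then show "gain_le (mat_diag n d) r"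
    by (simp add: gain_le_def mat_diag_def)
qed

lemma block_diag_mat_diag:
  "block_diag (mat_diag n a) (mat_diag k b) = mat_diag (n + k) (\<lambda>i. if i < n then a i else b (i - n))"
  by (rule eq_matI) (auto simp: block_diag_def mat_diag_def)

lemma smult_one_mat_eq_mat_diag: "c \<cdot>\<^sub>m 1\<^sub>m n = mat_diag n (\<lambda>_. c :: 'a :: semiring_1)"
  by (rule eq_matI) (auto simp: mat_diag_def)

lemma mat_diag_cong: "(\<And>i. i < n \<Longrightarrow> a i = b i) \<Longrightarrow> mat_diag n a = mat_diag n b"
  by (rule eq_matI) (auto simp: mat_diag_def)

lemma diag_block_mat_scalars:
  "diag_block_mat (map (\<lambda>k. \<delta> k \<cdot>\<^sub>m 1\<^sub>m 1) [a..<a + n]) = mat_diag n (\<lambda>i. \<delta> (a + i) :: 'a :: semiring_1)"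
proof (induction n)
  case 0
  then show ?case
    by (auto simp: mat_diag_def)
next
  case (Suc n)
  have "diag_block_mat (map (\<lambda>k. \<delta> k \<cdot>\<^sub>m 1\<^sub>m 1) [a..<a + Suc n]) =
      block_diag (mat_diag n (\<lambda>i. \<delta> (a + i))) (mat_diag 1 (\<lambda>_. \<delta> (a + n)))"
    using Suc by (simp add: diag_block_mat_append' smult_one_mat_eq_mat_diag del: One_nat_def diag_block_mat.simps(2))
  also have "\<dots> = mat_diag (Suc n) (\<lambda>i. \<delta> (a + i))"
    unfolding block_diag_mat_diag by (auto intro!: mat_diag_cong simp: less_Suc_eq)
  finally show ?case .
qed

text \<open>The diagonal is left anonymous on purpose: in passing to independent scalars the
  repetitions can be forgotten.\<close>

lemma diag_block_mat_repeated_scalars: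
  fixes \<delta> :: "nat \<Rightarrow> 'a :: semiring_1"
  shows "\<exists>e. diag_block_mat (map (\<lambda>i. \<delta> i \<cdot>\<^sub>m 1\<^sub>m (n i)) is) = mat_diag (sum_list (map n is)) e"
proof (induction "is")
  case Nil
  have "diag_block_mat [] = mat_diag 0 (\<lambda>_. 0 :: 'a)"
    by (auto simp: mat_diag_def)
  then show ?case
    by auto
next
  case (Cons i "is")
  then show ?case
    by (auto simp: diag_block_mat_Cons' smult_one_mat_eq_mat_diag block_diag_mat_diag
        simp del: diag_block_mat.simps)
qed

text \<open>The way back: a constant diagonal can be cut into repeated scalar blocks of any
  sizes.\<close>

lemma diag_block_mat_const_scalars:
  fixes c :: "'a :: semiring_1"
  shows "diag_block_mat (map (\<lambda>i. c \<cdot>\<^sub>m 1\<^sub>m (n i)) is) = mat_diag (sum_list (map n is)) (\<lambda>_. c)"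
proof (induction "is")
  case Nil
  show ?case
    by (auto simp: mat_diag_def)
next
  case (Cons i "is")
  then show ?case
    by (auto simp: diag_block_mat_Cons' smult_one_mat_eq_mat_diag block_diag_mat_diag
        simp del: diag_block_mat.simps(2) intro!: mat_diag_cong)
qed

section \<open>Moduli of vectors and the tailored nonnegative blocks\<close>

definition abs_vec :: "complex vec \<Rightarrow> real vec" where
  "abs_vec v = map_vec cmod v"

lemma abs_vec_carrier [simp]: "abs_vec v \<in> carrier_vec n \<longleftrightarrow> v \<in> carrier_vec n"
  by (simp add: abs_vec_def)

lemma abs_vec_index [simp]: "i < dim_vec v \<Longrightarrow> abs_vec v $ i = cmod (v $ i)"
  by (simp add: abs_vec_def)

lemma dim_abs_vec [simp]: "dim_vec (abs_vec v) = dim_vec v"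
  by (simp add: abs_vec_def)

lemma vnorm_abs_vec [simp]: "vnorm (abs_vec v) = vnorm v"
  by (simp add: vnorm_def cong: L2_set_cong_simp)

lemma abs_vec_append: "abs_vec (v @\<^sub>v w) = abs_vec v @\<^sub>v abs_vec w"
  by (rule eq_vecI) auto

text \<open>The entrywise modulus of a block can have a larger norm than the block itself, so the nonnegative
  block is instead tailored to the vector \<open>x\<close>. For \<open>x = 0\<close> the division by zero yields the zero block.\<close>

lemma nonneg_rank_one_block:
  assumes x: "x \<in> carrier_vec k" and y: "y \<in> carrier_vec k" and le: "vnorm y \<le> r * vnorm x" and r: "0 \<le> r"
  shows "\<exists>D \<in> carrier_mat k k. elements_mat D \<subseteq> {0..} \<and> gain_le (map_mat complex_of_real D) r \<and>
    D *\<^sub>v abs_vec x = abs_vec y"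
proof -
  define D where "D = mat k k (\<lambda>(i, j). cmod (y $ i) * cmod (x $ j) / (vnorm x)\<^sup>2)"
  have D: "D \<in> carrier_mat k k"
    by (simp add: D_def)
  have dim: "dim_vec x = k" "dim_vec y = k"
    using x y by auto
  have "elements_mat D \<subseteq> {0..}"
    by (auto simp: D_def dest!: elements_matD)
  moreover have "gain_le (map_mat complex_of_real D) r"
    unfolding gain_le_def
  proof
    fix v :: "complex vec" assume "v \<in> carrier_vec (dim_col (map_mat complex_of_real D))"
    then have v: "v \<in> carrier_vec k"
      by (simp add: D_def)
    \<comment> \<open>\<open>D\<close> maps \<open>v\<close> to |y| times
      \<open>p / (vnorm x)\<^sup>2\<close>, so Cauchy-Schwarz for \<open>p\<close> bounds its gain
      by \<open>vnorm y / vnorm x\<close>, which is at most \<open>r\<close>.\<close>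
    define p where "p = map_vec complex_of_real (abs_vec x) \<bullet> v"
    have "map_mat complex_of_real D *\<^sub>v v =
        (p / of_real ((vnorm x)\<^sup>2)) \<cdot>\<^sub>v map_vec complex_of_real (abs_vec y)"
      using v dim
      by (intro eq_vecI) (auto simp: D_def p_def scalar_prod_def sum_distrib_left sum_divide_distrib
          mult_ac intro!: sum.cong)
    then have "vnorm (map_mat complex_of_real D *\<^sub>v v) =
        cmod p / (vnorm x)\<^sup>2 * vnorm (map_vec complex_of_real (abs_vec y))"
      by (simp add: vnorm_smult norm_divide norm_power)
    also have "vnorm (map_vec complex_of_real (abs_vec y)) = vnorm y"
      by (simp add: vnorm_def cong: L2_set_cong_simp)
    also have "cmod p / (vnorm x)\<^sup>2 * vnorm y \<le> vnorm x * vnorm v / (vnorm x)\<^sup>2 * (r * vnorm x)"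
    proof -
      have "vnorm (map_vec complex_of_real (abs_vec x)) = vnorm x"
        by (simp add: vnorm_def cong: L2_set_cong_simp)
      then have "cmod p \<le> vnorm x * vnorm v"
        using scalar_prod_le_vnorm[of "map_vec complex_of_real (abs_vec x)" k v] x v by (simp add: p_def)
      then show ?thesis
        using le by (intro mult_mono divide_right_mono) auto
    qed
    also have "\<dots> \<le> r * vnorm v"
      using r by (cases "vnorm x = 0") (auto simp: power2_eq_square)
    finally show "vnorm (map_mat complex_of_real D *\<^sub>v v) \<le> r * vnorm v" .
  qed
  moreover have "D *\<^sub>v abs_vec x = abs_vec y"
  proof (cases "vnorm x = 0")
    case True
    then have "vnorm y = 0"
      using le vnorm_nonneg[of y] by simp
    then have "y = 0\<^sub>v k"
      using y by (simp add: vnorm_eq_0_iff)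
    then show ?thesis
      using dim by (intro eq_vecI) (auto simp: D_def scalar_prod_def)
  next
    case False
    have "(D *\<^sub>v abs_vec x) $ i = cmod (y $ i)" if "i < k" for i
    proof -
      have "(D *\<^sub>v abs_vec x) $ i = cmod (y $ i) / (vnorm x)\<^sup>2 * (\<Sum>j<k. (cmod (x $ j))\<^sup>2)"
        using that dim
        by (auto simp: D_def scalar_prod_def lessThan_atLeast0 sum_distrib_left power2_eq_square mult_ac
            intro!: sum.cong)
      also have "(\<Sum>j<k. (cmod (x $ j))\<^sup>2) = (vnorm x)\<^sup>2"
        using dim by (simp add: vnorm_square)
      finally show ?thesis
        using False by simp
    qed
    then show ?thesis
      using dim D by (intro eq_vecI) (auto simp del: index_mult_mat_vec)
  qed
  ultimately show ?thesis
    using D by blast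
qed

text \<open>The vector is cut along the blocks and each piece gets its own rank one block. All
  blocks share the bound \<open>r\<close>, so the norm of the assembled matrix is controlled as
  well.\<close>

lemma nonneg_diag_block_mat:
  assumes "distinct is" and "\<And>i. i \<in> set is \<Longrightarrow> B i \<in> carrier_mat (n i) (n i)"
    and "\<And>i. i \<in> set is \<Longrightarrow> gain_le (B i) r" and r: "0 \<le> r"
    and "x \<in> carrier_vec (sum_list (map n is))"
  shows "\<exists>D. (\<forall>i \<in> set is. D i \<in> carrier_mat (n i) (n i) \<and> elements_mat (D i) \<subseteq> {0..} \<and>
            gain_le (map_mat complex_of_real (D i)) r) \<and>
          diag_block_mat (map D is) *\<^sub>v abs_vec x = abs_vec (diag_block_mat (map B is) *\<^sub>v x)"
  using assms(1,2,3,5)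
proof (induction "is" arbitrary: x)
  case Nil
  then show ?case
    by (auto intro!: eq_vecI)
next
  case (Cons i "is")
  obtain x1 x2 where x: "x = x1 @\<^sub>v x2" and x1: "x1 \<in> carrier_vec (n i)"
      and x2: "x2 \<in> carrier_vec (sum_list (map n is))"
    using Cons.prems(4) vec_first_last_append[of x "n i" "sum_list (map n is)"]
    by (metis list.simps(9) sum_list.Cons vec_first_carrier vec_last_carrier)
  have Bi: "B i \<in> carrier_mat (n i) (n i)" "gain_le (B i) r"
    using Cons.prems by auto
  have rest: "distinct is" "\<And>j. j \<in> set is \<Longrightarrow> B j \<in> carrier_mat (n j) (n j)"
      "\<And>j. j \<in> set is \<Longrightarrow> gain_le (B j) r"
    using Cons.prems(1-3) by auto
  obtain D where D: "\<forall>j \<in> set is. D j \<in> carrier_mat (n j) (n j) \<and> elements_mat (D j) \<subseteq> {0..} \<and>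
        gain_le (map_mat complex_of_real (D j)) r"
      and Dx: "diag_block_mat (map D is) *\<^sub>v abs_vec x2 = abs_vec (diag_block_mat (map B is) *\<^sub>v x2)"
    using Cons.IH[OF rest x2] by blast
  have "B i *\<^sub>v x1 \<in> carrier_vec (n i)"
    using Bi x1 by auto
  then obtain E where E: "E \<in> carrier_mat (n i) (n i)" "elements_mat E \<subseteq> {0..}"
      "gain_le (map_mat complex_of_real E) r" "E *\<^sub>v abs_vec x1 = abs_vec (B i *\<^sub>v x1)"
    using nonneg_rank_one_block[OF x1 _ gain_leD[OF Bi(2,1) x1] r] by blast
  \<comment> \<open>Blocks are a function of the index, so only distinctness ensures that the update
    leaves the later blocks alone.\<close>
  define F where "F = D(i := E)"
  have F: "F i = E" "map F is = map D is"
    using Cons.prems(1) by (auto simp: F_def)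
  have "diag_block_mat (map F (i # is)) *\<^sub>v abs_vec x = abs_vec (diag_block_mat (map B (i # is)) *\<^sub>v x)"
  proof -
    have "diag_block_mat (map D is) \<in> carrier_mat (sum_list (map n is)) (sum_list (map n is))"
        "diag_block_mat (map B is) \<in> carrier_mat (sum_list (map n is)) (sum_list (map n is))"
      using D rest(2) by (auto intro: diag_block_mat_carrier)
    then show ?thesis
      unfolding F x abs_vec_append diag_block_mat_Cons' list.map(2)
      using x1 x2 by (simp add: block_diag_mult_vec[OF E(1)] block_diag_mult_vec[OF Bi(1)]
          E(4) Dx abs_vec_append)
  qed
  moreover have "\<forall>j \<in> set (i # is). F j \<in> carrier_mat (n j) (n j) \<and> elements_mat (F j) \<subseteq> {0..} \<and>
      gain_le (map_mat complex_of_real (F j)) r"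
    using D E by (auto simp: F_def)
  ultimately show ?case
    by blast
qed

subsection \<open>Comparison of the uncertainty sets\<close>

declare upt_Suc [simp del]

text \<open>The 1 x 1 blocks are merged into one diagonal block whose entries are counted from
  0.\<close>

lemma Delta_nonneg_iff:
  "\<Delta> \<in> Delta_nonneg f s ms \<longleftrightarrow>
    (\<exists>D d. \<Delta> = map_mat complex_of_real
        (block_diag (diag_block_mat (map D [1..<f + 1])) (mat_diag (\<Sum>k=f + 1..f + s. ms k) d)) \<and>
      (\<forall>k\<in>{1..f}. D k \<in> carrier_mat (ms k) (ms k) \<and> elements_mat (D k) \<subseteq> {0..}) \<and>
      (\<forall>i<(\<Sum>k=f + 1..f + s. ms k). 0 \<le> d i))" (is "_ \<longleftrightarrow> ?R")
proof
  define sbar where "sbar = (\<Sum>k=f + 1..f + s. ms k)"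
  have scalars: "diag_block_mat (map (\<lambda>k. \<delta> k \<cdot>\<^sub>m 1\<^sub>m 1) [f + 1..<f + sbar + 1]) = mat_diag sbar (\<lambda>i. \<delta> (f + 1 + i) :: real)"
    for \<delta>
    using diag_block_mat_scalars[of \<delta> "f + 1" sbar] by (simp add: ac_simps)
  show "?R" if \<Delta>: "\<Delta> \<in> Delta_nonneg f s ms"
  proof -
    obtain D \<delta> where "\<Delta> = map_mat complex_of_real (diag_block_mat (map D [1..<f + 1] @
              map (\<lambda>k. \<delta> k \<cdot>\<^sub>m 1\<^sub>m 1) [f + 1..<f + sbar + 1]))"
        and "\<forall>k\<in>{1..f}. D k \<in> carrier_mat (ms k) (ms k) \<and> elements_mat (D k) \<subseteq> {0..}"
        and "\<forall>k\<in>{f + 1..f + sbar}. 0 \<le> \<delta> k"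
      using \<Delta> unfolding Delta_nonneg_def Let_def mem_Collect_eq sbar_def[symmetric] by (elim exE conjE)
    then show ?thesis
      unfolding sbar_def[symmetric] diag_block_mat_append' scalars
      by (intro exI[of _ D] exI[of _ "\<lambda>i. \<delta> (f + 1 + i)"]) auto
  qed
  show "\<Delta> \<in> Delta_nonneg f s ms" if R: "?R"
  proof -
    obtain D d where \<Delta>: "\<Delta> = map_mat complex_of_real
          (block_diag (diag_block_mat (map D [1..<f + 1])) (mat_diag sbar d))"
        and D: "\<forall>k\<in>{1..f}. D k \<in> carrier_mat (ms k) (ms k) \<and> elements_mat (D k) \<subseteq> {0..}"
        and d: "\<forall>i<sbar. 0 \<le> d i"
      using R unfolding sbar_def[symmetric] by (elim exE conjE)
    \<comment> \<open>Scalar blocks are numbered from \<open>f + 1\<close>, diagonal entries from 0;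
      thus \<open>\<delta> (f + 1 + i) = d i\<close>.\<close>
    define \<delta> where "\<delta> k = d (k - (f + 1))" for k
    have "\<forall>k\<in>{f + 1..f + sbar}. 0 \<le> \<delta> k"
      using d by (auto simp: \<delta>_def)
    moreover have "\<Delta> = map_mat complex_of_real (diag_block_mat (map D [1..<f + 1] @
              map (\<lambda>k. \<delta> k \<cdot>\<^sub>m 1\<^sub>m 1) [f + 1..<f + sbar + 1]))"
      unfolding diag_block_mat_append' scalars \<Delta> by (simp add: \<delta>_def)
    ultimately show ?thesis
      using D unfolding Delta_nonneg_def Let_def mem_Collect_eq sbar_def[symmetric] by blast
  qed
qed

lemma sum_list_upt_Suc:
  "sum_list (map g [f + 1..<f + s + 1]) = (\<Sum>k=f + 1..f + s. g k :: nat)"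
proof -
  have "{f + 1..f + s} = set [f + 1..<f + s + 1]"
    by auto
  then show ?thesis
    by (simp only: interv_sum_list_conv_sum_set_nat)
qed

text \<open>Reality and repetition are dropped, because moduli are nonnegative reals in either case
  and the target set has independent scalars.\<close>

lemma Delta_RC_cases:
  assumes "\<Delta> \<in> Delta_RC f s ms IR"
  obtains D e where
    "\<Delta> = block_diag (diag_block_mat (map D [1..<f + 1])) (mat_diag (\<Sum>k=f + 1..f + s. ms k) e)"
    "\<And>k. k \<in> set [1..<f + 1] \<Longrightarrow> D k \<in> carrier_mat (ms k) (ms k)"
proof -
  obtain D \<delta> where \<Delta>: "\<Delta> = diag_block_mat (map D [1..<f + 1] @
              map (\<lambda>i. \<delta> i \<cdot>\<^sub>m 1\<^sub>m (ms i)) [f + 1..<f + s + 1])"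
      and D: "\<forall>i\<in>{1..f}. D i \<in> carrier_mat (ms i) (ms i) \<and> (i \<in> IR \<longrightarrow> elements_mat (D i) \<subseteq> \<real>)"
    using assms unfolding Delta_RC_def mem_Collect_eq by (elim exE conjE)
  obtain e where "diag_block_mat (map (\<lambda>i. \<delta> i \<cdot>\<^sub>m 1\<^sub>m (ms i)) [f + 1..<f + s + 1]) =
      mat_diag (\<Sum>k=f + 1..f + s. ms k) e"
    using diag_block_mat_repeated_scalars[of \<delta> ms "[f + 1..<f + s + 1]"] unfolding sum_list_upt_Suc by blast
  then show ?thesis
    using that[of D e] D unfolding \<Delta> diag_block_mat_append' by auto
qed

text \<open>Real data meet the constraints for every \<open>IR\<close>, and a single common scalar
  is compatible with all repetitions.\<close>

lemma Delta_RC_real: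
  assumes "\<And>k. k \<in> {1..f} \<Longrightarrow> D k \<in> carrier_mat (ms k) (ms k)"
  shows "map_mat complex_of_real
      (block_diag (diag_block_mat (map D [1..<f + 1])) (mat_diag (\<Sum>k=f + 1..f + s. ms k) (\<lambda>_. c)))
    \<in> Delta_RC f s ms IR" (is "?X \<in> _")
proof -
  have "?X = diag_block_mat (map (\<lambda>i. map_mat complex_of_real (D i)) [1..<f + 1] @
      map (\<lambda>i. complex_of_real c \<cdot>\<^sub>m 1\<^sub>m (ms i)) [f + 1..<f + s + 1])"
    unfolding diag_block_mat_append' diag_block_mat_const_scalars sum_list_upt_Suc
    by (simp add: map_block_diag map_diag_block_mat map_mat_diag)
  moreover have "\<forall>i\<in>{1..f}. map_mat complex_of_real (D i) \<in> carrier_mat (ms i) (ms i) \<and>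
      (i \<in> IR \<longrightarrow> elements_mat (map_mat complex_of_real (D i)) \<subseteq> \<real>)"
    using assms by auto
  moreover have "\<forall>i\<in>{f + 1..f + s}. i \<in> IR \<longrightarrow> complex_of_real c \<in> \<real>"
    by simp
  ultimately show ?thesis
    unfolding Delta_RC_def mem_Collect_eq
    by (intro exI[of _ "\<lambda>i. map_mat complex_of_real (D i)"] exI[of _ "\<lambda>_. complex_of_real c"] conjI)
qed

section \<open>Singularity by domination\<close>

lemma destabilizing_fixed_vector:
  assumes A: "A \<in> carrier_mat m m" and D: "D \<subseteq> carrier_mat m m" and \<Delta>: "\<Delta> \<in> destabilizing A D"
  shows "\<exists>z \<in> carrier_vec m. z \<noteq> 0\<^sub>v m \<and> z = A *\<^sub>v (\<Delta> *\<^sub>v z)"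
proof -
  have c: "\<Delta> \<in> carrier_mat m m" and "det (1\<^sub>m m - A * \<Delta>) = 0"
    using \<Delta> A D by (auto simp: destabilizing_def)
  moreover have I: "1\<^sub>m m - A * \<Delta> \<in> carrier_mat m m"
    using A c by (intro minus_carrier_mat mult_carrier_mat)
  ultimately obtain z where z: "z \<in> carrier_vec m" "z \<noteq> 0\<^sub>v m" "(1\<^sub>m m - A * \<Delta>) *\<^sub>v z = 0\<^sub>v m"
    using det_0_iff_vec_prod_zero[OF I] by auto
  have "z - A *\<^sub>v (\<Delta> *\<^sub>v z) = 0\<^sub>v m"
    using z A c minus_mult_distrib_mat_vec[of "1\<^sub>m m" m m "A * \<Delta>" z]
    by (simp add: assoc_mult_mat_vec[of _ m m _ m])
  then have "z $ i - (A *\<^sub>v (\<Delta> *\<^sub>v z)) $ i = 0" if "i < m" for i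
    using that A c z by (metis index_minus_vec(1) index_zero_vec(1) carrier_vecD mult_mat_vec_carrier)
  then have "z = A *\<^sub>v (\<Delta> *\<^sub>v z)"
    using A z(1) by (intro eq_vecI) (auto simp del: index_mult_mat_vec)
  with z show ?thesis
    by blast
qed

text \<open>Here \<open>w\<close> stands for \<open>\<Delta> z\<close>. Only its domination by
  \<open>P\<close> applied to |z| enters, so both directions of the comparison can use the result.
  Since \<open>M\<close> is nonnegative, |z| is at most \<open>M\<close> |w|, hence at most
  \<open>M P\<close> |z|.\<close>

lemma nonneg_scaling_singular:
  fixes M P :: "real mat"
  assumes M: "M \<in> carrier_mat m m" "elements_mat M \<subseteq> {0..}"
    and P: "P \<in> carrier_mat m m" "elements_mat P \<subseteq> {0..}"
    and z: "z \<in> carrier_vec m" "z \<noteq> 0\<^sub>v m" "z = map_mat complex_of_real M *\<^sub>v w"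
    and w: "w \<in> carrier_vec m" "\<And>i. i < m \<Longrightarrow> cmod (w $ i) \<le> (P *\<^sub>v abs_vec z) $ i"
  shows "\<exists>t. 0 \<le> t \<and> t \<le> 1 \<and>
    det (1\<^sub>m m - map_mat complex_of_real M * map_mat complex_of_real (t \<cdot>\<^sub>m P)) = 0"
proof -
  have M0: "0 \<le> M $$ (i, j)" and P0: "0 \<le> P $$ (i, j)" if "i < m" "j < m" for i j
    using M P that by (auto dest: elements_matI)
  have MP: "M * P \<in> carrier_mat m m"
    using M P by simp
  have "\<exists>t. 0 \<le> t \<and> t \<le> 1 \<and> det (1\<^sub>m m - t \<cdot>\<^sub>m (M * P)) = 0"
  proof (rule nonneg_subinvariant_imp_singular[OF MP])
    show "0 \<le> (M * P) $$ (i, j)" if "i < m" "j < m" for i j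
      using that M P M0 P0 by (auto simp: scalar_prod_def intro!: sum_nonneg)
    show "abs_vec z \<in> carrier_vec m"
      using z(1) by simp
    show "abs_vec z \<noteq> 0\<^sub>v m"
      using z(1,2) vnorm_abs_vec[of z] by (metis vnorm_eq_0_iff vnorm_zero)
    show "0 \<le> abs_vec z $ i" if "i < m" for i
      using that z(1) by simp
    show "abs_vec z $ i \<le> ((M * P) *\<^sub>v abs_vec z) $ i" if i: "i < m" for i
    proof -
      have Mc: "map_mat complex_of_real M \<in> carrier_mat m m"
        using M by simp
      have "abs_vec z $ i = cmod ((map_mat complex_of_real M *\<^sub>v w) $ i)"
        using i carrier_vecD[OF z(1)] by (subst z(3)[symmetric]) simp
      also have "\<dots> \<le> (\<Sum>j<m. M $$ (i, j) * cmod (w $ j))"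
        unfolding mult_mat_vec_index_sum[OF Mc w(1) i]
        using M(1) M0 i by (intro sum_norm_le) (auto simp: norm_mult)
      also have "\<dots> \<le> (\<Sum>j<m. M $$ (i, j) * (P *\<^sub>v abs_vec z) $ j)"
        using M0 i w(2) by (intro sum_mono mult_left_mono) auto
      also have "\<dots> = (M *\<^sub>v (P *\<^sub>v abs_vec z)) $ i"
        using P z(1) by (subst mult_mat_vec_index_sum[OF M(1) _ i]) auto
      also have "M *\<^sub>v (P *\<^sub>v abs_vec z) = (M * P) *\<^sub>v abs_vec z"
        using M P z(1) by (simp add: assoc_mult_mat_vec[of _ m m _ m])
      finally show ?thesis .
    qed
  qed
  then obtain t where t: "0 \<le> t" "t \<le> 1" "det (1\<^sub>m m - t \<cdot>\<^sub>m (M * P)) = 0"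
    by blast
  \<comment> \<open>The scaling moves from the product onto \<open>P\<close>, where it is part of
    the new uncertainty.\<close>
  have tMP: "t \<cdot>\<^sub>m (M * P) = M * (t \<cdot>\<^sub>m P)"
    using M P by (simp add: mult_smult_distrib)
  have "map_mat complex_of_real (1\<^sub>m m - M * (t \<cdot>\<^sub>m P)) =
      1\<^sub>m m - map_mat complex_of_real (M * (t \<cdot>\<^sub>m P))"
    using M P by (intro eq_matI) auto
  also have "map_mat complex_of_real (M * (t \<cdot>\<^sub>m P)) =
      map_mat complex_of_real M * map_mat complex_of_real (t \<cdot>\<^sub>m P)"
    using M P by (intro of_real_hom.mat_hom_mult) auto
  finally have "det (1\<^sub>m m - map_mat complex_of_real M * map_mat complex_of_real (t \<cdot>\<^sub>m P)) =
      complex_of_real (det (1\<^sub>m m - M * (t \<cdot>\<^sub>m P)))"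
    by (metis of_real_hom.hom_det)
  then have "det (1\<^sub>m m - map_mat complex_of_real M * map_mat complex_of_real (t \<cdot>\<^sub>m P)) = 0"
    using t(3) by (simp add: tMP)
  with t show ?thesis
    by blast
qed

text \<open>Mutual domination by norm equates the infima, which exist because norms are nonnegative.
  It also makes both destabilizing sets empty together, which settles the default value 0.\<close>

lemma structured_singular_value_eqI:
  assumes "D \<subseteq> carrier_mat m m" "D' \<subseteq> carrier_mat m m"
    and le: "\<And>\<Delta>. \<Delta> \<in> destabilizing A D \<Longrightarrow> \<exists>\<Delta>' \<in> destabilizing A D'. spectral_norm \<Delta>' \<le> spectral_norm \<Delta>"
    and ge: "\<And>\<Delta>. \<Delta> \<in> destabilizing A D' \<Longrightarrow> \<exists>\<Delta>' \<in> destabilizing A D. spectral_norm \<Delta>' \<le> spectral_norm \<Delta>"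
  shows "structured_singular_value A D = structured_singular_value A D'"
proof (cases "destabilizing A D = {}")
  case True
  then have "destabilizing A D' = {}"
    using ge by blast
  with True show ?thesis
    by (simp add: structured_singular_value_def)
next
  case False
  then have ne: "destabilizing A D' \<noteq> {}"
    using le by blast
  have bdd: "bdd_below (spectral_norm ` destabilizing A E)" if "E \<subseteq> carrier_mat m m" for E
    using that by (intro bdd_belowI[of _ 0]) (auto simp: destabilizing_def intro!: spectral_norm_nonneg)
  have "(INF \<Delta>\<in>destabilizing A D. spectral_norm \<Delta>) = (INF \<Delta>\<in>destabilizing A D'. spectral_norm \<Delta>)"
    by (intro antisym cINF_mono False ne bdd assms(1,2) le ge)
  then show ?thesis
    using False ne by (simp add: structured_singular_value_def)
qed

lemma gain_le_real_smult:
  assumes "A \<in> carrier_mat n k" "gain_le (map_mat complex_of_real A) r" "0 \<le> t" "t \<le> 1"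
  shows "gain_le (map_mat complex_of_real (t \<cdot>\<^sub>m A)) r"
proof -
  have "vnorm (map_mat complex_of_real (t \<cdot>\<^sub>m A) *\<^sub>v v) \<le> r * vnorm v" if v: "v \<in> carrier_vec k" for v
  proof -
    have "map_mat complex_of_real (t \<cdot>\<^sub>m A) = of_real t \<cdot>\<^sub>m map_mat complex_of_real A"
      by (rule eq_matI) auto
    then have "vnorm (map_mat complex_of_real (t \<cdot>\<^sub>m A) *\<^sub>v v) = t * vnorm (map_mat complex_of_real A *\<^sub>v v)"
      using assms(1,3) v smult_mat_mult_vec[of "map_mat complex_of_real A" n k v "of_real t"]
      by (simp add: vnorm_smult)
    also have "\<dots> \<le> vnorm (map_mat complex_of_real A *\<^sub>v v)"
      using assms(3,4) by (simp add: mult_left_le_one_le)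
    also have "\<dots> \<le> r * vnorm v"
      using gain_leD[OF assms(2) _ v] assms(1) by auto
    finally show ?thesis .
  qed
  then show ?thesis
    using assms(1) by (auto simp: gain_le_def)
qed

context
  fixes f s m :: nat and ms :: "nat \<Rightarrow> nat" and IR :: "nat set" and M :: "real mat"
  assumes ms: "(\<Sum>i=1..f + s. ms i) = m"
    and M: "M \<in> carrier_mat m m" "elements_mat M \<subseteq> {0..}"
begin

private abbreviation "sbar \<equiv> \<Sum>k=f + 1..f + s. ms k"
private abbreviation "fbar \<equiv> sum_list (map ms [1..<f + 1])"
private abbreviation "Mc \<equiv> map_mat complex_of_real M"

private lemma fbar_sbar: "fbar + sbar = m"
proof -
  have "{1..f + s} = {1..f} \<union> {f + 1..f + s}"
    by auto
  then have "m = sum ms {1..f} + sbar"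
    unfolding ms[symmetric] by (simp only:, subst sum.union_disjoint) auto
  then show ?thesis
    using sum_list_upt_Suc[of ms 0 f] by simp
qed

private lemma Mc: "Mc \<in> carrier_mat m m"
  using M by simp

text \<open>The common core of both directions. The diagonal is exhibited as \<open>t * d i\<close>
  rather than hidden behind a quantifier, because a constant \<open>d\<close> must remain constant
  to give repeated scalars.\<close>

private lemma nonneg_block_diag_destabilizing:
  assumes D: "\<And>k. k \<in> set [1..<f + 1] \<Longrightarrow> D k \<in> carrier_mat (ms k) (ms k) \<and> elements_mat (D k) \<subseteq> {0..} \<and>
        gain_le (map_mat complex_of_real (D k)) r"
    and d: "\<And>i. i < sbar \<Longrightarrow> 0 \<le> d i \<and> d i \<le> r" and r: "0 \<le> r"
    and z: "z \<in> carrier_vec m" "z \<noteq> 0\<^sub>v m" "z = Mc *\<^sub>v w" and w: "w \<in> carrier_vec m"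
    and le: "\<And>i. i < m \<Longrightarrow>
      cmod (w $ i) \<le> (block_diag (diag_block_mat (map D [1..<f + 1])) (mat_diag sbar d) *\<^sub>v abs_vec z) $ i"
  shows "\<exists>t D'. 0 \<le> t \<and>
    (\<forall>k\<in>{1..f}. D' k \<in> carrier_mat (ms k) (ms k) \<and> elements_mat (D' k) \<subseteq> {0..}) \<and>
    det (1\<^sub>m m - Mc * map_mat complex_of_real
       (block_diag (diag_block_mat (map D' [1..<f + 1])) (mat_diag sbar (\<lambda>i. t * d i)))) = 0 \<and>
    spectral_norm (map_mat complex_of_real
       (block_diag (diag_block_mat (map D' [1..<f + 1])) (mat_diag sbar (\<lambda>i. t * d i)))) \<le> r"
proof -
  define X where "X = diag_block_mat (map D [1..<f + 1])"
  define P where "P = block_diag X (mat_diag sbar d)"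
  have X: "X \<in> carrier_mat fbar fbar"
    unfolding X_def using D by (intro diag_block_mat_carrier) blast
  have P: "P \<in> carrier_mat m m"
    using block_diag_carrier[OF X mat_diag_dim[of sbar d]] unfolding P_def fbar_sbar .
  have "elements_mat X \<subseteq> {0..}"
    unfolding X_def using D by (intro elements_diag_block_mat_nonneg) auto
  moreover have "elements_mat (mat_diag sbar d) \<subseteq> {0..}"
    using d by (auto simp: mat_diag_def dest!: elements_matD)
  ultimately have P0: "elements_mat P \<subseteq> {0..}"
    unfolding P_def by (rule elements_block_diag_nonneg)
  have "gain_le (map_mat complex_of_real X) r"
    unfolding X_def using D r
    by (subst map_diag_block_mat, simp, subst gain_le_diag_block_mat[where n = ms]) auto
  moreover have "gain_le (map_mat complex_of_real (mat_diag sbar d)) r"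
    using d r by (auto simp: map_mat_diag gain_le_mat_diag)
  ultimately have gain: "gain_le (map_mat complex_of_real P) r"
    unfolding P_def using X r
    by (subst map_block_diag, simp, subst gain_le_block_diag[of _ fbar _ sbar]) (auto simp: map_mat_diag)
  obtain t where t: "0 \<le> t" "t \<le> 1" "det (1\<^sub>m m - Mc * map_mat complex_of_real (t \<cdot>\<^sub>m P)) = 0"
    using nonneg_scaling_singular[OF M P P0 z w] le unfolding P_def X_def by blast
  define D' where "D' = (\<lambda>k. t \<cdot>\<^sub>m D k)"
  have tP: "t \<cdot>\<^sub>m P = block_diag (diag_block_mat (map D' [1..<f + 1])) (mat_diag sbar (\<lambda>i. t * d i))"
    by (simp add: P_def X_def D'_def smult_block_diag smult_diag_block_mat smult_mat_diag)
  have D': "D' k \<in> carrier_mat (ms k) (ms k) \<and> elements_mat (D' k) \<subseteq> {0..}" if "k \<in> {1..f}" for k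
  proof -
    have Dk: "D k \<in> carrier_mat (ms k) (ms k)" "elements_mat (D k) \<subseteq> {0..}"
      using D[of k] that by auto
    then show ?thesis
      using t(1) by (force simp: D'_def dest!: elements_matD intro!: mult_nonneg_nonneg intro: elements_matI)
  qed
  have "spectral_norm (map_mat complex_of_real (t \<cdot>\<^sub>m P)) \<le> r"
    using gain_le_real_smult[OF P gain t(1,2)] P r by (intro spectral_norm_le[of _ m m]) auto
  then show ?thesis
    using t(1,3) D' unfolding tP by blast
qed

lemma destabilizing_Delta_RC_imp_nonneg:
  assumes "\<Delta> \<in> destabilizing Mc (Delta_RC f s ms IR)"
  shows "\<exists>\<Delta>' \<in> destabilizing Mc (Delta_nonneg f s ms). spectral_norm \<Delta>' \<le> spectral_norm \<Delta>"
proof -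
  define r where "r = spectral_norm \<Delta>"
  have \<Delta>c: "\<Delta> \<in> carrier_mat m m"
    using assms Delta_RC_carrier[OF ms] by (auto simp: destabilizing_def)
  have r: "0 \<le> r"
    unfolding r_def using spectral_norm_nonneg[OF \<Delta>c] .
  obtain D e where \<Delta>: "\<Delta> = block_diag (diag_block_mat (map D [1..<f + 1])) (mat_diag sbar e)"
      and D: "\<And>k. k \<in> set [1..<f + 1] \<Longrightarrow> D k \<in> carrier_mat (ms k) (ms k)"
    using assms Delta_RC_cases[of \<Delta> f s ms IR] unfolding destabilizing_def by blast
  define X where "X = diag_block_mat (map D [1..<f + 1])"
  have X: "X \<in> carrier_mat fbar fbar"
    unfolding X_def by (rule diag_block_mat_carrier[OF D])
  \<comment> \<open>The norm of the whole matrix becomes one bound \<open>r\<close> for every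
    block.\<close>
  have gain: "gain_le X r" "gain_le (mat_diag sbar e) r"
  proof -
    have "gain_le (block_diag X (mat_diag sbar e)) r"
      using gain_le_spectral_norm[OF \<Delta>c] by (simp only: \<Delta>[folded X_def, symmetric] r_def)
    then show "gain_le X r" "gain_le (mat_diag sbar e) r"
      unfolding gain_le_block_diag[OF X mat_diag_dim r] by blast+
  qed
  have gainD: "gain_le (D k) r" if "k \<in> set [1..<f + 1]" for k
    using gain(1) that D r gain_le_diag_block_mat[of "[1..<f + 1]" D ms r] unfolding X_def by blast
  have e: "cmod (e i) \<le> r" if "i < sbar" for i
    using gain(2) that unfolding gain_le_mat_diag[OF r] by blast
  obtain z where z: "z \<in> carrier_vec m" "z \<noteq> 0\<^sub>v m" "z = Mc *\<^sub>v (\<Delta> *\<^sub>v z)"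
    using destabilizing_fixed_vector[OF Mc Delta_RC_carrier[OF ms] assms] by blast
  obtain z1 z2 where z12: "z = z1 @\<^sub>v z2" "z1 \<in> carrier_vec fbar" "z2 \<in> carrier_vec sbar"
    using z(1) vec_first_last_append[of z fbar sbar] unfolding fbar_sbar
    by (metis vec_first_carrier vec_last_carrier)
  obtain E where E: "\<forall>k \<in> set [1..<f + 1]. E k \<in> carrier_mat (ms k) (ms k) \<and> elements_mat (E k) \<subseteq> {0..} \<and>
        gain_le (map_mat complex_of_real (E k)) r"
      and Ez: "diag_block_mat (map E [1..<f + 1]) *\<^sub>v abs_vec z1 = abs_vec (X *\<^sub>v z1)"
    using nonneg_diag_block_mat[OF distinct_upt D gainD r z12(2)] unfolding X_def by blast
  have Y: "diag_block_mat (map E [1..<f + 1]) \<in> carrier_mat fbar fbar"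
    using E by (intro diag_block_mat_carrier) blast
  have "mat_diag sbar (\<lambda>i. cmod (e i)) *\<^sub>v abs_vec z2 = abs_vec (mat_diag sbar e *\<^sub>v z2)"
  proof (rule eq_vecI)
    show "(mat_diag sbar (\<lambda>i. cmod (e i)) *\<^sub>v abs_vec z2) $ i = abs_vec (mat_diag sbar e *\<^sub>v z2) $ i"
      if "i < dim_vec (abs_vec (mat_diag sbar e *\<^sub>v z2))" for i
    proof -
      have "i < sbar"
        using that by (simp add: mat_diag_def)
      then show ?thesis
        using that z12(3) carrier_vecD[OF z12(3)]
        by (simp add: mat_diag_mult_vec_index norm_mult del: index_mult_mat_vec dim_mult_mat_vec)
    qed
  qed (simp add: mat_diag_def)
  \<comment> \<open>The domination holds with equality: every full block was built for its own piece
    of \<open>z\<close>, and moduli of scalars are multiplicative.\<close>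
  then have dominate: "block_diag (diag_block_mat (map E [1..<f + 1])) (mat_diag sbar (\<lambda>i. cmod (e i))) *\<^sub>v abs_vec z =
      abs_vec (\<Delta> *\<^sub>v z)"
    unfolding \<Delta> z12(1) X_def[symmetric] abs_vec_append block_diag_mult_vec[OF X mat_diag_dim z12(2,3)]
      block_diag_mult_vec[OF Y mat_diag_dim abs_vec_carrier[THEN iffD2, OF z12(2)] abs_vec_carrier[THEN iffD2, OF z12(3)]]
    by (simp only: Ez)
  have \<Delta>z: "\<Delta> *\<^sub>v z \<in> carrier_vec m"
    using \<Delta>c z(1) by simp
  have E': "E k \<in> carrier_mat (ms k) (ms k) \<and> elements_mat (E k) \<subseteq> {0..} \<and>
      gain_le (map_mat complex_of_real (E k)) r" if "k \<in> set [1..<f + 1]" for k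
    using E that by blast
  have e': "0 \<le> cmod (e i) \<and> cmod (e i) \<le> r" if "i < sbar" for i
    using e[OF that] by simp
  have le: "cmod ((\<Delta> *\<^sub>v z) $ i) \<le> (block_diag (diag_block_mat (map E [1..<f + 1]))
      (mat_diag sbar (\<lambda>i. cmod (e i))) *\<^sub>v abs_vec z) $ i" if "i < m" for i
    unfolding dominate using that carrier_vecD[OF \<Delta>z] by (simp del: index_mult_mat_vec dim_mult_mat_vec)
  have "\<exists>t D'. 0 \<le> t \<and>
      (\<forall>k\<in>{1..f}. D' k \<in> carrier_mat (ms k) (ms k) \<and> elements_mat (D' k) \<subseteq> {0..}) \<and>
      det (1\<^sub>m m - Mc * map_mat complex_of_real
        (block_diag (diag_block_mat (map D' [1..<f + 1])) (mat_diag sbar (\<lambda>i. t * cmod (e i))))) = 0 \<and>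
      spectral_norm (map_mat complex_of_real
        (block_diag (diag_block_mat (map D' [1..<f + 1])) (mat_diag sbar (\<lambda>i. t * cmod (e i))))) \<le> r"
    by (rule nonneg_block_diag_destabilizing[OF E' e' r z \<Delta>z le])
  then obtain t D' where t: "0 \<le> t"
      and D': "\<forall>k\<in>{1..f}. D' k \<in> carrier_mat (ms k) (ms k) \<and> elements_mat (D' k) \<subseteq> {0..}"
      and sing: "det (1\<^sub>m m - Mc * map_mat complex_of_real
         (block_diag (diag_block_mat (map D' [1..<f + 1])) (mat_diag sbar (\<lambda>i. t * cmod (e i))))) = 0"
      and norm: "spectral_norm (map_mat complex_of_real
         (block_diag (diag_block_mat (map D' [1..<f + 1])) (mat_diag sbar (\<lambda>i. t * cmod (e i))))) \<le> r"
    by blast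
  have "map_mat complex_of_real
         (block_diag (diag_block_mat (map D' [1..<f + 1])) (mat_diag sbar (\<lambda>i. t * cmod (e i))))
      \<in> Delta_nonneg f s ms"
    unfolding Delta_nonneg_iff using t D'
    by (intro exI[of _ D'] exI[of _ "\<lambda>i. t * cmod (e i)"] conjI refl) auto
  with sing have "map_mat complex_of_real
         (block_diag (diag_block_mat (map D' [1..<f + 1])) (mat_diag sbar (\<lambda>i. t * cmod (e i))))
      \<in> destabilizing Mc (Delta_nonneg f s ms)"
    unfolding destabilizing_def using Mc by simp
  with norm show ?thesis
    unfolding r_def by blast
qed

text \<open>Different scalars may sit where one repeated scalar is required. Replacing all of them
  by \<open>r\<close> enlarges the matrix entrywise, which preserves domination, yet keeps every
  block within the bound \<open>r\<close>.\<close>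

lemma destabilizing_Delta_nonneg_imp_RC:
  assumes "\<Delta> \<in> destabilizing Mc (Delta_nonneg f s ms)"
  shows "\<exists>\<Delta>' \<in> destabilizing Mc (Delta_RC f s ms IR). spectral_norm \<Delta>' \<le> spectral_norm \<Delta>"
proof -
  define r where "r = spectral_norm \<Delta>"
  have \<Delta>c: "\<Delta> \<in> carrier_mat m m"
    using assms Delta_nonneg_carrier[OF ms] by (auto simp: destabilizing_def)
  have r: "0 \<le> r"
    unfolding r_def using spectral_norm_nonneg[OF \<Delta>c] .
  have "\<Delta> \<in> Delta_nonneg f s ms"
    using assms by (simp add: destabilizing_def)
  then obtain D d where \<Delta>: "\<Delta> = map_mat complex_of_real
        (block_diag (diag_block_mat (map D [1..<f + 1])) (mat_diag sbar d))"
      and D: "\<forall>k\<in>{1..f}. D k \<in> carrier_mat (ms k) (ms k) \<and> elements_mat (D k) \<subseteq> {0..}"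
      and d: "\<forall>i<sbar. 0 \<le> d i"
    unfolding Delta_nonneg_iff by (elim exE conjE)
  define X where "X = diag_block_mat (map D [1..<f + 1])"
  have Dc: "D k \<in> carrier_mat (ms k) (ms k)" if "k \<in> set [1..<f + 1]" for k
    using D that by auto
  have X: "X \<in> carrier_mat fbar fbar"
    unfolding X_def by (rule diag_block_mat_carrier[OF Dc])
  have "elements_mat X \<subseteq> {0..}"
    unfolding X_def using D by (intro elements_diag_block_mat_nonneg) auto
  then have P0: "elements_mat (block_diag X (mat_diag sbar d)) \<subseteq> {0..}"
    using d by (intro elements_block_diag_nonneg) (auto simp: mat_diag_def dest!: elements_matD)
  have P: "block_diag X (mat_diag sbar d) \<in> carrier_mat m m"
    using block_diag_carrier[OF X mat_diag_dim[of sbar d]] unfolding fbar_sbar .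
  have \<Delta>': "\<Delta> = block_diag (map_mat complex_of_real X) (mat_diag sbar (\<lambda>i. complex_of_real (d i)))"
    unfolding \<Delta> X_def by (simp add: map_block_diag map_mat_diag)
  have Xc: "map_mat complex_of_real X \<in> carrier_mat fbar fbar"
    using X by simp
  have gain: "gain_le (map_mat complex_of_real X) r" "gain_le (mat_diag sbar (\<lambda>i. complex_of_real (d i))) r"
  proof -
    have "gain_le (block_diag (map_mat complex_of_real X) (mat_diag sbar (\<lambda>i. complex_of_real (d i)))) r"
      using gain_le_spectral_norm[OF \<Delta>c] by (simp only: \<Delta>'[symmetric] r_def)
    then show "gain_le (map_mat complex_of_real X) r" "gain_le (mat_diag sbar (\<lambda>i. complex_of_real (d i))) r"
      unfolding gain_le_block_diag[OF Xc mat_diag_dim r] by blast+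
  qed
  have gainD: "gain_le (map_mat complex_of_real (D k)) r" if "k \<in> set [1..<f + 1]" for k
    using gain(1) that Dc unfolding X_def
    by (subst (asm) map_diag_block_mat, simp, subst (asm) gain_le_diag_block_mat[where n = ms]) (auto simp: r)
  have dr: "d i \<le> r" if "i < sbar" for i
    using gain(2) that d unfolding gain_le_mat_diag[OF r] by auto
  obtain z where z: "z \<in> carrier_vec m" "z \<noteq> 0\<^sub>v m" "z = Mc *\<^sub>v (\<Delta> *\<^sub>v z)"
    using destabilizing_fixed_vector[OF Mc Delta_nonneg_carrier[OF ms] assms] by blast
  obtain z1 z2 where z12: "abs_vec z = z1 @\<^sub>v z2" "z1 \<in> carrier_vec fbar" "z2 \<in> carrier_vec sbar"
    using z(1) vec_first_last_append[of "abs_vec z" fbar sbar] unfolding fbar_sbar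
    by (metis abs_vec_carrier vec_first_carrier vec_last_carrier)
  have le: "cmod ((\<Delta> *\<^sub>v z) $ i) \<le> (block_diag X (mat_diag sbar (\<lambda>_. r)) *\<^sub>v abs_vec z) $ i" if i: "i < m" for i
  proof -
    have "cmod ((\<Delta> *\<^sub>v z) $ i) \<le> (\<Sum>j<m. block_diag X (mat_diag sbar d) $$ (i, j) * abs_vec z $ j)"
    proof -
      have "0 \<le> block_diag X (mat_diag sbar d) $$ (i, j)" if "j < m" for j
        using elements_matI[OF P i that refl] P0 by auto
      then show ?thesis
        unfolding mult_mat_vec_index_sum[OF \<Delta>c z(1) i]
        unfolding \<Delta> X_def[symmetric]
        using P i z(1) by (intro sum_norm_le) (auto simp: norm_mult)
    qed
    also have "\<dots> = (block_diag X (mat_diag sbar d) *\<^sub>v abs_vec z) $ i"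
      using z(1) by (intro mult_mat_vec_index_sum[OF P _ i, symmetric]) simp
    \<comment> \<open>Rows of the full blocks are unchanged; in the remaining rows
      \<open>d i\<close> grows to \<open>r\<close> against a nonnegative entry of |z|.\<close>
    also have "\<dots> \<le> (block_diag X (mat_diag sbar (\<lambda>_. r)) *\<^sub>v abs_vec z) $ i"
    proof (cases "i < fbar")
      case True
      then show ?thesis
        using X unfolding z12(1) block_diag_mult_vec[OF X mat_diag_dim z12(2,3)] by simp
    next
      case False
      then have k: "i - fbar < sbar"
        using i fbar_sbar by linarith
      have "0 \<le> abs_vec z $ i"
        using i z(1) by simp
      then have "0 \<le> z2 $ (i - fbar)"
        unfolding z12(1) using False k z12(2,3) by simp
      then have "d (i - fbar) * z2 $ (i - fbar) \<le> r * z2 $ (i - fbar)"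
        using dr[OF k] by (intro mult_right_mono)
      then show ?thesis
        unfolding z12(1) block_diag_mult_vec[OF X mat_diag_dim z12(2,3)]
        using X False k z12(2,3) i by (simp add: mat_diag_mult_vec_index del: index_mult_mat_vec)
    qed
    finally show ?thesis .
  qed
  have \<Delta>z: "\<Delta> *\<^sub>v z \<in> carrier_vec m"
    using \<Delta>c z(1) by simp
  have "\<exists>t D'. 0 \<le> t \<and>
      (\<forall>k\<in>{1..f}. D' k \<in> carrier_mat (ms k) (ms k) \<and> elements_mat (D' k) \<subseteq> {0..}) \<and>
      det (1\<^sub>m m - Mc * map_mat complex_of_real
        (block_diag (diag_block_mat (map D' [1..<f + 1])) (mat_diag sbar (\<lambda>_. t * r)))) = 0 \<and>
      spectral_norm (map_mat complex_of_real
        (block_diag (diag_block_mat (map D' [1..<f + 1])) (mat_diag sbar (\<lambda>_. t * r)))) \<le> r"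
    by (rule nonneg_block_diag_destabilizing[OF _ _ r z \<Delta>z le[unfolded X_def]])
      (use D gainD r in auto)
  then obtain t D' where D': "\<forall>k\<in>{1..f}. D' k \<in> carrier_mat (ms k) (ms k) \<and> elements_mat (D' k) \<subseteq> {0..}"
      and sing: "det (1\<^sub>m m - Mc * map_mat complex_of_real
         (block_diag (diag_block_mat (map D' [1..<f + 1])) (mat_diag sbar (\<lambda>_. t * r)))) = 0"
      and norm: "spectral_norm (map_mat complex_of_real
         (block_diag (diag_block_mat (map D' [1..<f + 1])) (mat_diag sbar (\<lambda>_. t * r)))) \<le> r"
    by blast
  have "map_mat complex_of_real
         (block_diag (diag_block_mat (map D' [1..<f + 1])) (mat_diag sbar (\<lambda>_. t * r)))
      \<in> destabilizing Mc (Delta_RC f s ms IR)"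
    unfolding destabilizing_def using sing Mc Delta_RC_real[of f D' ms s "t * r" IR] D' by simp
  with norm show ?thesis
    unfolding r_def by blast
qed

end

theorem corollary5:
  fixes f s m :: nat and ms :: "nat \<Rightarrow> nat" and IR IC :: "nat set" and M :: "real mat"
  assumes "\<And>i. i \<in> {1..f + s} \<Longrightarrow> 1 \<le> ms i"
    and "(\<Sum>i=1..f + s. ms i) = m"
    and "IR \<union> IC = {1..f + s}" and "IR \<inter> IC = {}"
    and "M \<in> carrier_mat m m" and "elements_mat M \<subseteq> {0..}"
  shows "(robustly_stable_unit_ball (map_mat complex_of_real M) (Delta_RC f s ms IR) \<longleftrightarrow>
          robustly_stable_unit_ball (map_mat complex_of_real M) (Delta_nonneg f s ms)) \<and>
         structured_singular_value (map_mat complex_of_real M) (Delta_RC f s ms IR) =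
         structured_singular_value (map_mat complex_of_real M) (Delta_nonneg f s ms)"
proof -
  have "structured_singular_value (map_mat complex_of_real M) (Delta_RC f s ms IR) =
      structured_singular_value (map_mat complex_of_real M) (Delta_nonneg f s ms)"
    by (intro structured_singular_value_eqI[OF Delta_RC_carrier[OF assms(2)] Delta_nonneg_carrier[OF assms(2)]]
        destabilizing_Delta_RC_imp_nonneg[OF assms(2,5,6)] destabilizing_Delta_nonneg_imp_RC[OF assms(2,5,6)])
  then show ?thesis
    by (simp add: robustly_stable_unit_ball_def)
qed

end
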